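(* Let $B=(B_t)_{t\ge0}$ be a standard Brownian motion started at $0$. Let $f\in C([0,\infty),\mathbb{R})$ be such that $f(0)\neq0$ and let $\alpha\ne0$, $\beta$ be two fixed reals. Then, for any $t<\zeta_{\alpha,\beta}$, $$\mathbb{P}\left(T^{S^{\alpha,\beta}f}\in dt\right)=\alpha^3(1+\alpha\beta t)^{-\frac52}\,e^{-\frac{\alpha\beta}{2(1+\alpha\beta t)}(S^{\alpha,\beta}f(t))^2}\;S^{\alpha,\beta}\left(\mathbb{P}(T^f\in dt)\right).$$
   Context: $\zeta_{\alpha,\beta}=-\frac{1}{\alpha\beta}$ if $\alpha\beta<0$ and $\zeta_{\alpha,\beta}=+\infty$ otherwise. For $0\le t<\zeta_{\alpha,\beta}$, $$S^{\alpha,\beta}f(t)=\left(\frac{1+\alpha\beta t}{\alpha}\right)f\left(\frac{\alpha^2t}{1+\alpha\beta t}\right).$$ $T^f=\inf\{t>0: B_t=f(t)\}$ with $\inf\emptyset=\infty$; for a curve $g$ defined only on $[0,\zeta_{\alpha,\beta})$, $T^g=\inf\{0<t<\zeta_{\alpha,\beta}: B_t=g(t)\}$. Action of $S^{\alpha,\beta}$ on measures: if $\mu(dt)=h(t)\,dt$, then $S^{\alpha,\beta}(\mu)(dt)=S^{\alpha,\beta}h(t)\,dt$ on $(0,\zeta_{\alpha,\beta})$. For a general measure $\mu$ on $(0,\infty)$ this is read as $S^{\alpha,\beta}(\mu)(dt)=\frac{(1+\alpha\beta t)^3}{\alpha^3}\,\nu(dt)$ on $(0,\zeta_{\alpha,\beta})$,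 where, with $\theta(t)=\frac{\alpha^2t}{1+\alpha\beta t}$, $\nu$ is the image under $\theta^{-1}$ of the restriction of $\mu$ to the range $\theta((0,\zeta_{\alpha,\beta}))$; this agrees with the previous definition when $\mu$ has a density. *)

theory Defs
  imports "HOL-Probability.Probability"
begin

locale standard_brownian_motion = prob_space M
  for M :: "'a measure" and B :: "real \<Rightarrow> 'a \<Rightarrow> real" +
  assumes random_variable_B: "\<And>t. 0 \<le> t \<Longrightarrow> random_variable borel (B t)"
    and start_at_0: "AE \<omega> in M. B 0 \<omega> = 0"
    and normal_increments: "\<And>s t. \<lbrakk>0 \<le> s; s < t\<rbrakk> \<Longrightarrow>
          distributed M lborel (\<lambda>\<omega>. B t \<omega> - B s \<omega>) (normal_density 0 (sqrt (t - s)))"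
    and indep_increments: "\<And>(\<tau> :: nat \<Rightarrow> real) n.
          \<lbrakk>0 \<le> \<tau> 0; \<And>i. i < n \<Longrightarrow> \<tau> i \<le> \<tau> (Suc i)\<rbrakk> \<Longrightarrow>
          indep_vars (\<lambda>_. borel) (\<lambda>i \<omega>. B (\<tau> (Suc i)) \<omega> - B (\<tau> i) \<omega>) {..<n}"
    and continuous_paths: "\<And>\<omega>. \<omega> \<in> space M \<Longrightarrow> continuous_on {0..} (\<lambda>t. B t \<omega>)"

definition zeta :: "real \<Rightarrow> real \<Rightarrow> ereal" where
  "zeta \<alpha> \<beta> = (if \<alpha> * \<beta> < 0 then ereal (- 1 / (\<alpha> * \<beta>)) else \<infinity>)"

definition lifetime :: "real \<Rightarrow> real \<Rightarrow> real set" where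
  "lifetime \<alpha> \<beta> = {t. 0 < t \<and> ereal t < zeta \<alpha> \<beta>}"

definition theta :: "real \<Rightarrow> real \<Rightarrow> real \<Rightarrow> real" where
  "theta \<alpha> \<beta> t = \<alpha>\<^sup>2 * t / (1 + \<alpha> * \<beta> * t)"

text \<open>Only the values of \<open>S_fun \<alpha> \<beta> f\<close> at \<open>0 \<le> t < zeta \<alpha> \<beta>\<close> are meaningful.\<close>

definition S_fun :: "real \<Rightarrow> real \<Rightarrow> (real \<Rightarrow> real) \<Rightarrow> real \<Rightarrow> real" where
  "S_fun \<alpha> \<beta> f t = (1 + \<alpha> * \<beta> * t) / \<alpha> * f (theta \<alpha> \<beta> t)"

text \<open>First hitting time of a curve \<open>g\<close> that is defined on \<open>[0, z)\<close>; it is \<open>\<infinity>\<close> if the curve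
  is never hit, since \<open>Inf {} = \<infinity>\<close> in \<open>ereal\<close>.\<close>

definition hitting_time ::
  "(real \<Rightarrow> 'a \<Rightarrow> real) \<Rightarrow> ereal \<Rightarrow> (real \<Rightarrow> real) \<Rightarrow> 'a \<Rightarrow> ereal" where
  "hitting_time B z g \<omega> = Inf (ereal ` {t. 0 < t \<and> ereal t < z \<and> B t \<omega> = g t})"

text \<open>The measure \<open>P(T \<in> dt)\<close> on \<open>(0, \<infinity>)\<close>, regarded as a Borel measure on the real line;
  its total mass is \<open>P(0 < T < \<infinity>)\<close>.\<close>

definition hitting_law :: "'a measure \<Rightarrow> ('a \<Rightarrow> ereal) \<Rightarrow> real measure" where
  "hitting_law M T =
     distr (restrict_space (distr M borel T) {0<..<\<infinity>}) borel real_of_ereal"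

text \<open>For \<open>\<alpha> < 0\<close> the operator \<open>S\<close> turns a measure into the negative of a measure, hence signed
  measures are needed. The pair \<open>(p, q)\<close> stands for the signed measure \<open>p - q\<close>.\<close>

type_synonym signed_measure = "real measure \<times> real measure"

definition signed_set_integrable ::
  "signed_measure \<Rightarrow> real set \<Rightarrow> (real \<Rightarrow> real) \<Rightarrow> bool" where
  "signed_set_integrable m A g \<longleftrightarrow>
     set_integrable (fst m) A g \<and> set_integrable (snd m) A g"

definition signed_set_integral ::
  "signed_measure \<Rightarrow> real set \<Rightarrow> (real \<Rightarrow> real) \<Rightarrow> real" where
  "signed_set_integral m A g = (LINT t:A|fst m. g t) - (LINT t:A|snd m. g t)"

text \<open>The signed measure \<open>w(t) \<mu>(dt)\<close>. Note that \<open>ennreal\<close> truncates negative numbers to \<open>0\<close>,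
  so that the two components are \<open>w\<^sup>+ \<mu>\<close> and \<open>w\<^sup>- \<mu>\<close>.\<close>

definition signed_density :: "real measure \<Rightarrow> (real \<Rightarrow> real) \<Rightarrow> signed_measure" where
  "signed_density \<mu> w =
     (density \<mu> (\<lambda>t. ennreal (w t)), density \<mu> (\<lambda>t. ennreal (- w t)))"

definition theta_pullback :: "real \<Rightarrow> real \<Rightarrow> real measure \<Rightarrow> real measure" where
  "theta_pullback \<alpha> \<beta> \<mu> =
     distr (restrict_space \<mu> (theta \<alpha> \<beta> ` lifetime \<alpha> \<beta>)) borel
       (the_inv_into (lifetime \<alpha> \<beta>) (theta \<alpha> \<beta>))"

text \<open>If \<open>\<mu>(dt) = h(t) dt\<close>, then \<open>theta_pullback \<alpha> \<beta> \<mu>\<close> has the density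
  \<open>\<alpha>\<^sup>2 / (1 + \<alpha>\<beta>t)\<^sup>2 * h (theta \<alpha> \<beta> t)\<close> on \<open>lifetime \<alpha> \<beta>\<close>, and the
  following is the signed measure with density \<open>S_fun \<alpha> \<beta> h\<close>.\<close>

definition S_measure :: "real \<Rightarrow> real \<Rightarrow> real measure \<Rightarrow> signed_measure" where
  "S_measure \<alpha> \<beta> \<mu> =
     signed_density (theta_pullback \<alpha> \<beta> \<mu>) (\<lambda>t. (1 + \<alpha> * \<beta> * t) ^ 3 / \<alpha> ^ 3)"

end

(* Let c = alpha * beta. The process X_t = (1 + c t) / alpha * B_{theta(t)} hits S f at time t exactly
   when B hits f at time theta(t), so the pullback of the law of T^f under theta is the law of the
   hitting time of S f by X. On the time interval [0, t] the law of B has the density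
     N_t = sqrt (1 + c t) * exp (- c x^2 / (2 (1 + c t))),   x = X_t,
   with respect to the law of X: on finite-dimensional laws this is an identity between Gaussian
   transition densities. Cutting (a, b] into small intervals and using the density at the right end
   point of each of them, dominated convergence replaces N_t by its value at the hitting time T, which
   is the deterministic function of T obtained from x = S f(T). N_t is bounded only for c >= 0; for
   c < 0 the same argument is applied to 1 / N_t with the roles of X and B exchanged. *)
theory Submission
  imports Defs
begin

text \<open>Why the density sees the path only through its last value: \<open>X\<close> is a centred
  Gaussian process with covariance \<open>s * (1 + c * t)\<close> for \<open>s \<le> t\<close>.
  Conditioned on its value at \<open>t\<close> it is, on \<open>[0, t]\<close>, the same Brownian
  bridge as \<open>B\<close>, so \<open>N_t\<close> is the ratio of two centred normal densities
  with variances \<open>t\<close> and \<open>t * (1 + c * t)\<close>. The exponent -5/2 is 1/2 - 3: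
  the square root in \<open>N_t\<close>, divided by the factor
  \<open>(1 + c * t) ^ 3 / \<alpha> ^ 3\<close> of \<open>S_measure\<close>, in which two powers of
  \<open>1 + c * t\<close> undo the Jacobian of \<open>theta\<close>. The obstacle is that
  \<open>B\<close> is given by independent increments and continuity, while \<open>T > s\<close>
  involves uncountably many times. Dyadic grids reduce it to finite-dimensional laws, and no
  martingale property is needed: an event up to time \<open>s\<close> is weighted at a later time
  \<open>t\<close> by appending \<open>t\<close> to the grid with the factor 1. For
  \<open>c < 0\<close> the factor \<open>1 + c * t\<close> vanishes at \<open>zeta\<close>, so
  bounds exist only on \<open>[0, b]\<close> with \<open>b\<close> below \<open>zeta\<close>; the
  rest follows by exhaustion. Since the roles of \<open>X\<close> and \<open>B\<close> depend on the
  sign of \<open>c\<close>, the transfer is done for an abstract pair of processes and weight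
  \<open>K\<close>.\<close>

section \<open>Hitting times of continuous processes\<close>

text \<open>Compactness gives a positive minimum of the absolute value of \<open>d\<close>, and the
  dyadic points are dense. The uniform level \<open>1 / Suc k\<close> is essential: \<open>d\<close>
  could vanish only off the grids, and only a closed lower bound survives the passage to the limit.
  For fixed \<open>k\<close> and \<open>m\<close> finitely many times are involved, which suits both
  measurability and finite-dimensional laws.\<close>

lemma nonzero_iff_dyadic:
  fixes d :: "real \<Rightarrow> real"
  assumes "a \<le> b" and cont: "continuous_on {a..b} d"
  shows "(\<forall>t\<in>{a..b}. d t \<noteq> 0) \<longleftrightarrow>
    (\<exists>k::nat. \<forall>m::nat. \<forall>i\<le>2 ^ m. 1 / Suc k \<le> \<bar>d (a + (b - a) * real i / 2 ^ m)\<bar>)"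
    (is "?L \<longleftrightarrow> ?R")
proof
  assume ?L
  have "continuous_on {a..b} (\<lambda>t. \<bar>d t\<bar>)"
    by (intro continuous_intros cont)
  from continuous_attains_inf[OF _ _ this] \<open>a \<le> b\<close>
  obtain u where u: "u \<in> {a..b}" "\<And>t. t \<in> {a..b} \<Longrightarrow> \<bar>d u\<bar> \<le> \<bar>d t\<bar>"
    by auto
  with \<open>?L\<close> have "\<bar>d u\<bar> > 0" by auto
  then obtain k :: nat where k: "1 / Suc k < \<bar>d u\<bar>"
    using nat_approx_posE by blast
  have "a + (b - a) * real i / 2 ^ m \<in> {a..b}" if "i \<le> 2 ^ m" for i m :: nat
  proof -
    have "real i \<le> 2 ^ m" using that by (metis of_nat_le_iff of_nat_numeral of_nat_power)
    then have "real i / 2 ^ m \<le> 1" by simp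
    from mult_left_mono[OF this, of "b - a"] show ?thesis using \<open>a \<le> b\<close> by auto
  qed
  with u(2) k show ?R by (meson less_imp_le order_trans)
next
  assume ?R
  then obtain k :: nat where
    k: "\<And>m i. i \<le> 2 ^ m \<Longrightarrow> 1 / Suc k \<le> \<bar>d (a + (b - a) * real i / 2 ^ m)\<bar>" by blast
  show ?L
  proof (intro ballI notI)
    fix t assume t: "t \<in> {a..b}" and "d t = 0"
    \<comment> \<open>If \<open>a = b\<close>, division by zero yields \<open>r = 0\<close>, which
      still parametrises the only point of the interval.\<close>
    define r where "r = (t - a) / (b - a)"
    have r: "0 \<le> r" "r \<le> 1" using t by (auto simp: r_def divide_simps)
    have tr: "t = a + (b - a) * r" using t by (auto simp: r_def)
    define i where "i m = nat \<lfloor>r * 2 ^ m\<rfloor>" for m :: nat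
    have i_real: "real (i m) = of_int \<lfloor>r * 2 ^ m\<rfloor>" for m
      using r by (simp add: i_def)
    have i: "i m \<le> 2 ^ m" for m
    proof -
      have "r * 2 ^ m \<le> 2 ^ m" using r by simp
      then have "real (i m) \<le> 2 ^ m" unfolding i_real by linarith
      then show ?thesis by (metis of_nat_le_iff of_nat_numeral of_nat_power)
    qed
    have "(\<lambda>m. real (i m) / 2 ^ m) \<longlonglongrightarrow> r"
    proof (rule real_tendsto_sandwich)
      show "\<forall>\<^sub>F m in sequentially. r - (1 / 2) ^ m \<le> real (i m) / 2 ^ m"
      proof (rule always_eventually, rule allI)
        fix m
        have "r * 2 ^ m - 1 \<le> real (i m)" unfolding i_real by linarith
        from divide_right_mono[OF this, of "2 ^ m"] show "r - (1 / 2) ^ m \<le> real (i m) / 2 ^ m"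
          by (simp add: diff_divide_distrib power_one_over)
      qed
      show "\<forall>\<^sub>F m in sequentially. real (i m) / 2 ^ m \<le> r"
        unfolding i_real by (simp add: divide_le_eq)
      show "(\<lambda>m. r - (1 / 2) ^ m) \<longlonglongrightarrow> r"
        using tendsto_diff[OF tendsto_const LIMSEQ_realpow_zero[of "1/2::real"]] by simp
    qed auto
    then have lim: "(\<lambda>m. a + (b - a) * (real (i m) / 2 ^ m)) \<longlonglongrightarrow> t"
      unfolding tr by (intro tendsto_intros)
    have "(\<lambda>m. d (a + (b - a) * (real (i m) / 2 ^ m))) \<longlonglongrightarrow> d t"
    proof (rule continuous_on_tendsto_compose[OF cont lim t])
      have "a + (b - a) * (real (i m) / 2 ^ m) \<in> {a..b}" for m
      proof -
        have "real (i m) \<le> 2 ^ m" using i[of m] by (metis of_nat_le_iff of_nat_numeral of_nat_power)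
        then have "real (i m) / 2 ^ m \<le> 1" by simp
        from mult_left_mono[OF this, of "b - a"] show ?thesis using \<open>a \<le> b\<close> by auto
      qed
      then show "\<forall>\<^sub>F m in sequentially. a + (b - a) * (real (i m) / 2 ^ m) \<in> {a..b}" by simp
    qed
    then have "(\<lambda>m. \<bar>d (a + (b - a) * (real (i m) / 2 ^ m))\<bar>) \<longlonglongrightarrow> \<bar>d t\<bar>"
      by (rule tendsto_rabs)
    then have "1 / Suc k \<le> \<bar>d t\<bar>"
      by (rule tendsto_lowerbound) (use k[OF i] in auto)
    with \<open>d t = 0\<close> show False by simp
  qed
qed

text \<open>The bound \<open>z\<close> is present because the transformed curve and the time-changed
  process make sense only before \<open>zeta\<close>. A hitting time ignores time 0;
  \<open>start_off_curve\<close> makes it harmless to include 0, so that closed intervals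
  \<open>{0..s}\<close> and compactness can be used.\<close>

locale continuous_process = prob_space M
  for M :: "'a measure" and X :: "real \<Rightarrow> 'a \<Rightarrow> real" and z :: ereal and g :: "real \<Rightarrow> real" +
  assumes random_variable_X: "\<And>t. \<lbrakk>0 \<le> t; ereal t < z\<rbrakk> \<Longrightarrow> random_variable borel (X t)"
    and continuous_X: "\<And>\<omega>. \<omega> \<in> space M \<Longrightarrow> continuous_on {t. 0 \<le> t \<and> ereal t < z} (\<lambda>t. X t \<omega>)"
    and continuous_g: "continuous_on {t. 0 \<le> t \<and> ereal t < z} g"
    and start_off_curve: "AE \<omega> in M. X 0 \<omega> \<noteq> g 0"
begin

lemma continuous_diff:
  "\<omega> \<in> space M \<Longrightarrow> continuous_on {t. 0 \<le> t \<and> ereal t < z} (\<lambda>t. X t \<omega> - g t)"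
  by (intro continuous_intros continuous_X continuous_g)

lemma Icc_subset: "0 \<le> a \<Longrightarrow> ereal b < z \<Longrightarrow> {a..b} \<subseteq> {t. 0 \<le> t \<and> ereal t < z}"
  by (auto intro: le_less_trans[of _ "ereal b"])

lemma off_curve_iff_dyadic:
  assumes "0 \<le> a" "a \<le> b" "ereal b < z" "\<omega> \<in> space M"
  shows "(\<forall>t\<in>{a..b}. X t \<omega> \<noteq> g t) \<longleftrightarrow>
    (\<exists>k::nat. \<forall>m::nat. \<forall>i\<le>2 ^ m. 1 / Suc k \<le>
        \<bar>X (a + (b - a) * real i / 2 ^ m) \<omega> - g (a + (b - a) * real i / 2 ^ m)\<bar>)"
  using nonzero_iff_dyadic[OF assms(2) continuous_on_subset[OF continuous_diff[OF assms(4)]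
    Icc_subset[OF assms(1,3)]]] by simp

lemma dyadic_mem:
  assumes "0 \<le> a" "a \<le> b" "ereal b < z" "i \<le> 2 ^ m"
  shows "0 \<le> a + (b - a) * real i / 2 ^ m \<and> ereal (a + (b - a) * real i / 2 ^ m) < z"
proof -
  have "real i \<le> 2 ^ m" using assms(4) by (metis of_nat_le_iff of_nat_numeral of_nat_power)
  then have "real i / 2 ^ m \<le> 1" by simp
  from mult_left_mono[OF this, of "b - a"] assms
  have "a + (b - a) * real i / 2 ^ m \<in> {a..b}" by auto
  with Icc_subset[OF assms(1,3)] show ?thesis by blast
qed

lemma off_curve_sets:
  assumes "0 \<le> a" "ereal b < z"
  shows "{\<omega> \<in> space M. \<forall>t\<in>{a..b}. X t \<omega> \<noteq> g t} \<in> sets M"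
proof (cases "a \<le> b")
  case True
  note [measurable] = random_variable_X
  have "{\<omega> \<in> space M. \<forall>t\<in>{a..b}. X t \<omega> \<noteq> g t} =
    {\<omega> \<in> space M. \<exists>k::nat. \<forall>m::nat. \<forall>i\<in>{..2 ^ m}. 1 / Suc k \<le>
        \<bar>X (a + (b - a) * real i / 2 ^ m) \<omega> - g (a + (b - a) * real i / 2 ^ m)\<bar>}"
    by (intro Collect_cong conj_cong refl, subst off_curve_iff_dyadic[OF assms(1) True assms(2)])
      (simp_all only: Ball_def atMost_iff)
  also have "\<dots> = (\<Union>k. \<Inter>m. \<Inter>i\<in>{..2 ^ m}. {\<omega> \<in> space M. 1 / Suc k \<le>
        \<bar>X (a + (b - a) * real i / 2 ^ m) \<omega> - g (a + (b - a) * real i / 2 ^ m)\<bar>})"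
    by auto
  also have "\<dots> \<in> sets M"
  proof (intro sets.countable_UN sets.countable_INT sets.finite_INT image_subsetI)
    fix k m i :: nat
    assume "i \<in> {..2 ^ m}"
    with dyadic_mem[OF assms(1) True assms(2), of i m]
    have "random_variable borel (X (a + (b - a) * real i / 2 ^ m))"
      using random_variable_X by auto
    then show "{\<omega> \<in> space M. 1 / Suc k \<le>
        \<bar>X (a + (b - a) * real i / 2 ^ m) \<omega> - g (a + (b - a) * real i / 2 ^ m)\<bar>} \<in> sets M"
      by measurable
  qed auto
  finally show ?thesis .
qed simp

text \<open>With a strict inequality \<open>T < y\<close> the infimum need not be attained: it
  suffices that some hit occurs before \<open>y\<close>, and this is a countable union of
  complements of the events in \<open>off_curve_sets\<close>.\<close>

lemma hitting_time_measurable [measurable]: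
  "hitting_time X z g \<in> borel_measurable M"
proof (rule borel_measurableI_less)
  fix y :: ereal
  \<comment> \<open>The rational intervals \<open>[p, q]\<close> inside \<open>(0, min z y)\<close>;
    every hit before \<open>y\<close> lies in one of them.\<close>
  define Q where "Q = {(p::rat, q::rat). 0 < (of_rat p :: real) \<and> ereal (of_rat q) < z \<and> ereal (of_rat q) < y}"
  have *: "(\<exists>t. 0 < t \<and> ereal t < z \<and> X t \<omega> = g t \<and> ereal t < y) \<longleftrightarrow>
    (\<exists>(p, q)\<in>Q. \<exists>t\<in>{of_rat p..of_rat q}. X t \<omega> = g t)" for \<omega>
  proof
    assume "\<exists>t. 0 < t \<and> ereal t < z \<and> X t \<omega> = g t \<and> ereal t < y"
    then obtain t where t: "0 < t" "ereal t < min z y" "X t \<omega> = g t" by auto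
    obtain p where p: "0 < (of_rat p :: real)" "of_rat p < t"
      using of_rat_dense[OF t(1)] by auto
    obtain u where u: "ereal t < ereal u" "ereal u < min z y"
      using ereal_dense2[OF t(2)] by auto
    then obtain q where q: "t < of_rat q" "of_rat q < u"
      using of_rat_dense[of t u] by auto
    have "ereal (of_rat q) < min z y" using q(2) u(2) by (meson less_ereal.simps(1) less_trans)
    with p q have "(p, q) \<in> Q" "t \<in> {of_rat p..of_rat q}" by (auto simp: Q_def)
    with t(3) show "\<exists>(p, q)\<in>Q. \<exists>t\<in>{of_rat p..of_rat q}. X t \<omega> = g t" by blast
  next
    assume "\<exists>(p, q)\<in>Q. \<exists>t\<in>{of_rat p..of_rat q}. X t \<omega> = g t"
    then obtain p q t where "(p, q) \<in> Q" "t \<in> {of_rat p..of_rat q}" "X t \<omega> = g t" by blast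
    moreover then have "ereal t < z" "ereal t < y"
      by (auto simp: Q_def intro: le_less_trans[of _ "ereal (of_rat q)"])
    moreover from \<open>(p, q) \<in> Q\<close> \<open>t \<in> {of_rat p..of_rat q}\<close> have "0 < t"
      unfolding Q_def by (auto simp del: zero_less_of_rat_iff)
    ultimately show "\<exists>t. 0 < t \<and> ereal t < z \<and> X t \<omega> = g t \<and> ereal t < y" by blast
  qed
  have "{\<omega> \<in> space M. hitting_time X z g \<omega> < y} =
    {\<omega> \<in> space M. \<exists>t. 0 < t \<and> ereal t < z \<and> X t \<omega> = g t \<and> ereal t < y}"
    by (auto simp: hitting_time_def Inf_less_iff)
  also have "\<dots> = (\<Union>(p, q)\<in>Q. space M -
      {\<omega> \<in> space M. \<forall>t\<in>{of_rat p..of_rat q}. X t \<omega> \<noteq> g t})"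
    unfolding * by auto
  also have "\<dots> \<in> sets M"
  proof (intro sets.countable_UN'' countableI_type)
    fix pq assume "pq \<in> Q"
    then show "(case pq of (p, q) \<Rightarrow> space M -
      {\<omega> \<in> space M. \<forall>t\<in>{of_rat p..of_rat q}. X t \<omega> \<noteq> g t}) \<in> sets M"
      by (cases pq) (auto simp: Q_def intro!: sets.Diff off_curve_sets)
  qed
  finally show "{\<omega> \<in> space M. hitting_time X z g \<omega> < y} \<in> sets M" .
qed

text \<open>Absence of hits up to \<open>s\<close> alone would only give \<open>s \<le> T\<close>.
  Continuity at \<open>s\<close> keeps the path off the curve for a further time \<open>e\<close>,
  which makes the inequality strict.\<close>

lemma hitting_time_greater_iff:
  assumes "\<omega> \<in> space M" "X 0 \<omega> \<noteq> g 0" "0 \<le> s" "ereal s < z"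
  shows "ereal s < hitting_time X z g \<omega> \<longleftrightarrow> (\<forall>t\<in>{0..s}. X t \<omega> \<noteq> g t)"
proof
  assume *: "ereal s < hitting_time X z g \<omega>"
  show "\<forall>t\<in>{0..s}. X t \<omega> \<noteq> g t"
  proof (intro ballI notI)
    fix t assume t: "t \<in> {0..s}" "X t \<omega> = g t"
    with assms(2) have "0 < t" by (cases "t = 0") auto
    moreover have "ereal t < z" using t Icc_subset[OF _ assms(4), of 0] by auto
    ultimately have "hitting_time X z g \<omega> \<le> ereal t"
      unfolding hitting_time_def using t by (intro Inf_lower) auto
    with * t show False by (meson atLeastAtMost_iff ereal_less_eq(3) not_less order_trans)
  qed
next
  assume *: "\<forall>t\<in>{0..s}. X t \<omega> \<noteq> g t"
  let ?D = "{t. 0 \<le> t \<and> ereal t < z}"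
  have "((\<lambda>t. X t \<omega> - g t) \<longlongrightarrow> X s \<omega> - g s) (at s within ?D)"
    using continuous_diff[OF assms(1)] assms(3,4) by (auto simp: continuous_on_def)
  moreover have "X s \<omega> - g s \<noteq> 0" using * assms(3) by auto
  ultimately have "\<forall>\<^sub>F t in at s within ?D. X t \<omega> - g t \<noteq> 0"
    by (rule tendsto_imp_eventually_ne)
  then obtain e where e: "e > 0" "\<And>t. t \<in> ?D \<Longrightarrow> t \<noteq> s \<Longrightarrow> dist t s < e \<Longrightarrow> X t \<omega> - g t \<noteq> 0"
    unfolding eventually_at by auto
  have "ereal (s + e) \<le> hitting_time X z g \<omega>"
    unfolding hitting_time_def
  proof (rule Inf_greatest)
    fix y assume "y \<in> ereal ` {t. 0 < t \<and> ereal t < z \<and> X t \<omega> = g t}"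
    then obtain t where t: "y = ereal t" "0 < t" "ereal t < z" "X t \<omega> = g t" by auto
    have "\<not> t \<le> s" using * t by auto
    with e(2)[of t] t have "\<not> dist t s < e" by auto
    with \<open>\<not> t \<le> s\<close> show "ereal (s + e) \<le> y" by (auto simp: t dist_real_def)
  qed
  with e(1) show "ereal s < hitting_time X z g \<omega>"
    by (meson less_add_same_cancel1 less_ereal.simps(1) less_le_trans)
qed

text \<open>Since \<open>T > t\<close> fails, some hit occurs at a time \<open>u \<le> t\<close>;
  since \<open>T > u\<close> for every \<open>u < t\<close>, it occurs at \<open>t\<close>
  itself.\<close>

lemma on_curve_at_hitting_time:
  assumes "\<omega> \<in> space M" "X 0 \<omega> \<noteq> g 0" "hitting_time X z g \<omega> = ereal t" "0 < t" "ereal t < z"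
  shows "X t \<omega> = g t"
proof -
  from hitting_time_greater_iff[OF assms(1,2), of t] assms(3-)
  obtain u where u: "u \<in> {0..t}" "X u \<omega> = g u" by auto
  have "u = t"
  proof (rule ccontr)
    assume "u \<noteq> t"
    with u have "u < t" by auto
    moreover have "ereal u < z" using u Icc_subset[OF _ assms(5), of 0] by auto
    ultimately have "X u \<omega> \<noteq> g u" using hitting_time_greater_iff[OF assms(1,2), of u] assms(3) u by auto
    with u show False by simp
  qed
  with u show ?thesis by simp
qed

end

section \<open>Hitting times under a change of law\<close>

text \<open>The law of \<open>X\<close> on \<open>[0, t]\<close> has the density \<open>K t (W t)\<close> with respect to the law of \<open>W\<close>. Only
  expectations of products are assumed, since staying off the curve at finitely many times is a
  product event.\<close>

locale markovian_density = X: continuous_process M X z g + W: continuous_process M W z g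
  for M :: "'a measure" and X W :: "real \<Rightarrow> 'a \<Rightarrow> real" and z :: ereal and g :: "real \<Rightarrow> real" +
  fixes K :: "real \<Rightarrow> real \<Rightarrow> real"
  assumes K_measurable: "\<And>t. K t \<in> borel_measurable borel"
    and K_nonneg: "\<And>t x. \<lbrakk>0 \<le> t; ereal t < z\<rbrakk> \<Longrightarrow> 0 \<le> K t x"
    and K_continuous: "\<And>x. continuous_on {t. 0 \<le> t \<and> ereal t < z} x \<Longrightarrow>
        continuous_on {t. 0 \<le> t \<and> ereal t < z} (\<lambda>t. K t (x t))"
    and K_bounded: "\<And>b. \<lbrakk>0 \<le> b; ereal b < z\<rbrakk> \<Longrightarrow> \<exists>C. \<forall>t\<in>{0..b}. \<forall>x. K t x \<le> C"
    and finite_dim_density: "\<And>(\<tau> :: nat \<Rightarrow> real) n (h :: nat \<Rightarrow> real \<Rightarrow> ennreal).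
        \<lbrakk>\<tau> 0 = 0; \<And>i. i < n \<Longrightarrow> \<tau> i \<le> \<tau> (Suc i); ereal (\<tau> n) < z;
         \<And>i. h i \<in> borel_measurable borel\<rbrakk> \<Longrightarrow>
        (\<integral>\<^sup>+\<omega>. (\<Prod>i\<le>n. h i (X (\<tau> i) \<omega>)) \<partial>M) =
        (\<integral>\<^sup>+\<omega>. (\<Prod>i\<le>n. h i (W (\<tau> i) \<omega>)) * K (\<tau> n) (W (\<tau> n) \<omega>) \<partial>M)"
begin

abbreviation weighted :: "real \<Rightarrow> 'a measure" where
  "weighted t \<equiv> density M (\<lambda>\<omega>. ennreal (K t (W t \<omega>)))"

lemma measurable_weight [measurable]:
  assumes "0 \<le> t" "ereal t < z"
  shows "(\<lambda>\<omega>. ennreal (K t (W t \<omega>))) \<in> borel_measurable M"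
  using W.random_variable_X[OF assms] K_measurable by measurable

lemma emeasure_weighted:
  assumes "0 \<le> t" "ereal t < z" "E \<in> sets M"
  shows "emeasure (weighted t) E = (\<integral>\<^sup>+\<omega>. indicator E \<omega> * ennreal (K t (W t \<omega>)) \<partial>M)"
  using measurable_weight[OF assms(1,2)] assms(3)
  by (subst emeasure_density) (auto simp: mult.commute)

text \<open>The indicator of the event is a product over the grid, to which
  \<open>finite_dim_density\<close> applies. The weight is taken at any \<open>t \<ge> s\<close>,
  not just at \<open>s\<close>, so that later two events with different \<open>s\<close> can be
  compared under one weighted measure.\<close>

lemma off_curve_dyadic_transfer:
  fixes s t \<epsilon> :: real and m :: nat
  assumes "0 \<le> s" "s \<le> t" "ereal t < z"
  defines "p \<equiv> \<lambda>i::nat. s * real i / 2 ^ m"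
  shows "emeasure M {\<omega> \<in> space M. \<forall>i\<le>2 ^ m. \<epsilon> \<le> \<bar>X (p i) \<omega> - g (p i)\<bar>} =
    emeasure (weighted t) {\<omega> \<in> space M. \<forall>i\<le>2 ^ m. \<epsilon> \<le> \<bar>W (p i) \<omega> - g (p i)\<bar>}"
proof -
  \<comment> \<open>The grid on \<open>[0, s]\<close> is followed by the single time
    \<open>t\<close>, at which \<open>h\<close> is 1: the event is unchanged, but the density is now
    taken at \<open>t\<close>.\<close>
  define \<tau> where "\<tau> i = (if i \<le> 2 ^ m then p i else t)" for i
  define h where "h i x = (if i \<le> (2::nat) ^ m then indicator {x. \<epsilon> \<le> \<bar>x - g (p i)\<bar>} x else 1 :: ennreal)"
    for i and x :: real
  have p: "0 \<le> p i \<and> ereal (p i) < z" "p i \<le> t" if "i \<le> 2 ^ m" for i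
  proof -
    have "real i \<le> 2 ^ m" using that by (metis of_nat_le_iff of_nat_numeral of_nat_power)
    then have "real i / 2 ^ m \<le> 1" by simp
    from mult_left_mono[OF this, of s] assms show "p i \<le> t" by (auto simp: p_def)
    moreover have "0 \<le> p i" using assms(1) by (simp add: p_def)
    ultimately show "0 \<le> p i \<and> ereal (p i) < z" using X.Icc_subset[OF _ assms(3), of 0] by auto
  qed
  have ms: "{\<omega> \<in> space M. \<forall>i\<le>2 ^ m. \<epsilon> \<le> \<bar>Y (p i) \<omega> - g (p i)\<bar>} \<in> sets M"
    if "\<And>t. \<lbrakk>0 \<le> t; ereal t < z\<rbrakk> \<Longrightarrow> Y t \<in> borel_measurable M" for Y
  proof -
    have "{\<omega> \<in> space M. \<forall>i\<le>2 ^ m. \<epsilon> \<le> \<bar>Y (p i) \<omega> - g (p i)\<bar>} =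
      (\<Inter>i\<in>{..2 ^ m}. {\<omega> \<in> space M. \<epsilon> \<le> \<bar>Y (p i) \<omega> - g (p i)\<bar>})" by auto
    also have "\<dots> \<in> sets M"
    proof (intro sets.finite_INT)
      fix i assume "i \<in> {..(2::nat) ^ m}"
      then have [measurable]: "Y (p i) \<in> borel_measurable M" using p that by auto
      show "{\<omega> \<in> space M. \<epsilon> \<le> \<bar>Y (p i) \<omega> - g (p i)\<bar>} \<in> sets M" by measurable
    qed auto
    finally show ?thesis .
  qed
  have prod: "(\<Prod>i\<le>Suc (2 ^ m). h i (Y (\<tau> i) \<omega>)) =
      indicator {\<omega> \<in> space M. \<forall>i\<le>2 ^ m. \<epsilon> \<le> \<bar>Y (p i) \<omega> - g (p i)\<bar>} \<omega>"
    if "\<omega> \<in> space M" for Y and \<omega>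
  proof -
    have "(\<Prod>i\<le>Suc (2 ^ m). h i (Y (\<tau> i) \<omega>)) = (\<Prod>i\<le>2 ^ m. h i (Y (p i) \<omega>))"
      by (simp add: h_def \<tau>_def)
    also have "\<dots> = indicator {\<omega> \<in> space M. \<forall>i\<le>2 ^ m. \<epsilon> \<le> \<bar>Y (p i) \<omega> - g (p i)\<bar>} \<omega>"
    proof (cases "\<forall>i\<le>2 ^ m. \<epsilon> \<le> \<bar>Y (p i) \<omega> - g (p i)\<bar>")
      case True
      then show ?thesis using that by (auto simp: h_def intro!: prod.neutral)
    next
      case False
      then show ?thesis using that by (auto simp: h_def indicator_def intro!: prod_zero)
    qed
    finally show ?thesis .
  qed
  have \<tau>_last: "\<tau> (Suc (2 ^ m)) = t" by (simp add: \<tau>_def)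
  have "emeasure M {\<omega> \<in> space M. \<forall>i\<le>2 ^ m. \<epsilon> \<le> \<bar>X (p i) \<omega> - g (p i)\<bar>} =
    (\<integral>\<^sup>+\<omega>. indicator {\<omega> \<in> space M. \<forall>i\<le>2 ^ m. \<epsilon> \<le> \<bar>X (p i) \<omega> - g (p i)\<bar>} \<omega> \<partial>M)"
    by (rule nn_integral_indicator[symmetric], rule ms, rule X.random_variable_X)
  also have "\<dots> = (\<integral>\<^sup>+\<omega>. (\<Prod>i\<le>Suc (2 ^ m). h i (X (\<tau> i) \<omega>)) \<partial>M)"
    by (rule nn_integral_cong, rule prod[of _ X, symmetric])
  also have "\<dots> = (\<integral>\<^sup>+\<omega>. (\<Prod>i\<le>Suc (2 ^ m). h i (W (\<tau> i) \<omega>)) *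
      K (\<tau> (Suc (2 ^ m))) (W (\<tau> (Suc (2 ^ m))) \<omega>) \<partial>M)"
  proof (rule finite_dim_density)
    show "\<tau> 0 = 0" by (simp add: \<tau>_def p_def)
    show "ereal (\<tau> (Suc (2 ^ m))) < z" using assms by (simp add: \<tau>_def)
    show "h i \<in> borel_measurable borel" for i
      unfolding h_def by (cases "i \<le> 2 ^ m") simp_all
    show "\<tau> i \<le> \<tau> (Suc i)" if "i < Suc (2 ^ m)" for i
      using that p(2)[of i] \<open>0 \<le> s\<close> by (auto simp: \<tau>_def p_def intro!: divide_right_mono mult_left_mono)
  qed
  also have "\<dots> = (\<integral>\<^sup>+\<omega>. indicator {\<omega> \<in> space M. \<forall>i\<le>2 ^ m. \<epsilon> \<le> \<bar>W (p i) \<omega> - g (p i)\<bar>} \<omega> *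
      ennreal (K t (W t \<omega>)) \<partial>M)"
  proof (rule nn_integral_cong)
    fix \<omega> assume "\<omega> \<in> space M"
    from prod[OF this, of W] show "(\<Prod>i\<le>Suc (2 ^ m). h i (W (\<tau> i) \<omega>)) *
        ennreal (K (\<tau> (Suc (2 ^ m))) (W (\<tau> (Suc (2 ^ m))) \<omega>)) =
      indicator {\<omega> \<in> space M. \<forall>i\<le>2 ^ m. \<epsilon> \<le> \<bar>W (p i) \<omega> - g (p i)\<bar>} \<omega> * ennreal (K t (W t \<omega>))"
      unfolding \<tau>_last by (rule arg_cong)
  qed
  also have "\<dots> = emeasure (weighted t) {\<omega> \<in> space M. \<forall>i\<le>2 ^ m. \<epsilon> \<le> \<bar>W (p i) \<omega> - g (p i)\<bar>}"
    using assms(1-3) by (intro emeasure_weighted[symmetric] ms[of W] W.random_variable_X) simp_all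
  finally show ?thesis .
qed

lemma finite_weighted:
  assumes "0 \<le> t" "ereal t < z"
  shows "finite_measure (weighted t)"
proof
  \<comment> \<open>For level 0 the dyadic event is the whole space, so the transfer shows that the
    weight has expectation 1.\<close>
  have "emeasure (weighted t) (space M) \<le> 1"
    using off_curve_dyadic_transfer[of t t 0 0] assms
    by (simp add: X.emeasure_space_1)
  then show "emeasure (weighted t) (space (weighted t)) \<noteq> \<infinity>"
    by (auto simp: top_unique)
qed

lemma dyadic_step_le:
  fixes P :: "real \<Rightarrow> bool" and s :: real
  assumes "m \<le> n" "\<forall>i\<le>(2::nat) ^ n. P (s * real i / 2 ^ n)"
  shows "\<forall>i\<le>(2::nat) ^ m. P (s * real i / 2 ^ m)"
proof (intro allI impI)
  fix i :: nat assume "i \<le> 2 ^ m"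
  have e: "(2::nat) ^ n = 2 ^ m * 2 ^ (n - m)" using assms(1) by (simp flip: power_add)
  then have "i * 2 ^ (n - m) \<le> 2 ^ n" using \<open>i \<le> 2 ^ m\<close> by simp
  with assms(2) have "P (s * real (i * 2 ^ (n - m)) / 2 ^ n)" by blast
  also have "s * real (i * 2 ^ (n - m)) / 2 ^ n = s * real i / 2 ^ m"
    using arg_cong[OF e, of real] by simp
  finally show "P (s * real i / 2 ^ m)" .
qed

text \<open>Staying off the curve is an increasing union over the level \<open>k\<close> of
  decreasing intersections over the mesh \<open>m\<close> of dyadic events. Both measures are
  continuous along these limits; the decreasing one requires finiteness of the weighted
  measure.\<close>

lemma off_curve_transfer:
  assumes "0 \<le> s" "s \<le> t" "ereal t < z"
  shows "emeasure M {\<omega> \<in> space M. \<forall>u\<in>{0..s}. X u \<omega> \<noteq> g u} =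
    emeasure (weighted t) {\<omega> \<in> space M. \<forall>u\<in>{0..s}. W u \<omega> \<noteq> g u}"
proof -
  define E where "E Y k m = {\<omega> \<in> space M. \<forall>i\<le>2 ^ m. 1 / real (Suc k) \<le>
      \<bar>Y (s * real i / 2 ^ m) \<omega> - g (s * real i / 2 ^ m)\<bar>}" for Y :: "real \<Rightarrow> 'a \<Rightarrow> real" and k m :: nat
  have sz: "ereal s < z" using assms X.Icc_subset[OF _ assms(3), of 0] by auto
  interpret weighted: finite_measure "weighted t"
    by (rule finite_weighted) (use assms in auto)
  \<comment> \<open>Stated for an arbitrary process and measure because it is used twice: for
    \<open>X\<close> under \<open>M\<close> and for \<open>W\<close> under
    \<open>weighted t\<close>.\<close>
  have eq: "emeasure N {\<omega> \<in> space M. \<forall>u\<in>{0..s}. Y u \<omega> \<noteq> g u} = (SUP k. INF m. emeasure N (E Y k m))"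
    if "continuous_process M Y z g" "finite_measure N" "sets N = sets M" for Y N
  proof -
    interpret Y: continuous_process M Y z g by fact
    interpret N: finite_measure N by fact
    have [measurable]: "E Y k m \<in> sets N" for k m
    proof -
      have "E Y k m = (\<Inter>i\<in>{..2 ^ m}. {\<omega> \<in> space M. 1 / real (Suc k) \<le>
        \<bar>Y (s * real i / 2 ^ m) \<omega> - g (s * real i / 2 ^ m)\<bar>})" by (auto simp: E_def)
      also have "\<dots> \<in> sets M"
      proof (intro sets.finite_INT)
        fix i assume "i \<in> {..(2::nat) ^ m}"
        then have [measurable]: "Y (s * real i / 2 ^ m) \<in> borel_measurable M"
          using Y.dyadic_mem[of 0 s i m] assms(1) sz by (intro Y.random_variable_X) auto
        show "{\<omega> \<in> space M. 1 / real (Suc k) \<le>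
          \<bar>Y (s * real i / 2 ^ m) \<omega> - g (s * real i / 2 ^ m)\<bar>} \<in> sets M" by measurable
      qed auto
      finally show ?thesis using that by simp
    qed
    have "{\<omega> \<in> space M. \<forall>u\<in>{0..s}. Y u \<omega> \<noteq> g u} = (\<Union>k. \<Inter>m. E Y k m)"
      using Y.off_curve_iff_dyadic[of 0 s] assms(1) sz by (auto simp: E_def)
    also have "emeasure N \<dots> = (SUP k. emeasure N (\<Inter>m. E Y k m))"
    proof (rule SUP_emeasure_incseq[symmetric])
      have "E Y k m \<subseteq> E Y k' m" if "k \<le> k'" for k k' m
      proof -
        have "1 / real (Suc k') \<le> 1 / real (Suc k)" using that by (simp add: frac_le)
        then show ?thesis unfolding E_def by (blast intro: order_trans)
      qed
      then show "incseq (\<lambda>k. \<Inter>m. E Y k m)" unfolding incseq_def by blast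
    qed auto
    also have "\<dots> = (SUP k. INF m. emeasure N (E Y k m))"
    proof (intro SUP_cong refl INF_emeasure_decseq[symmetric])
      fix k
      show "decseq (E Y k)"
        unfolding decseq_def E_def
        using dyadic_step_le[of _ _ "\<lambda>u. 1 / real (Suc k) \<le> \<bar>Y u _ - g u\<bar>" s] by blast
    qed auto
    finally show ?thesis .
  qed
  have "emeasure M (E X k m) = emeasure (weighted t) (E W k m)" for k m
    unfolding E_def by (rule off_curve_dyadic_transfer[OF assms])
  with eq[of X M] eq[of W "weighted t"] show ?thesis
    using X.continuous_process_axioms W.continuous_process_axioms X.finite_measure_axioms
      weighted.finite_measure_axioms by simp
qed

end

text \<open>Uniqueness of measures on a generator needs finiteness, and the hypotheses control only
  intervals bounded away from \<open>0\<close> and \<open>z\<close>. Hence \<open>A\<close> is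
  exhausted by its parts in such intervals.\<close>

lemma measure_eq_on_subintervals:
  fixes \<mu> \<nu> :: "real measure" and z :: ereal
  assumes sets: "sets \<mu> = sets borel" "sets \<nu> = sets borel"
    and eq: "\<And>a b. \<lbrakk>0 < a; a \<le> b; ereal b < z\<rbrakk> \<Longrightarrow> emeasure \<mu> {a<..b} = emeasure \<nu> {a<..b}"
    and fin: "\<And>a b. \<lbrakk>0 < a; a \<le> b; ereal b < z\<rbrakk> \<Longrightarrow> emeasure \<mu> {a<..b} < \<infinity>"
    and A: "A \<in> sets borel" "A \<subseteq> {t. 0 < t \<and> ereal t < z}"
  shows "emeasure \<mu> A = emeasure \<nu> A"
proof (cases "0 < z")
  case False
  have "\<not> (0 < t \<and> ereal t < z)" for t
    using False less_trans[of 0 "ereal t" z] by auto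
  then have "A = {}" using A(2) by blast
  then show ?thesis by simp
next
  case True
  note [measurable_cong] = sets
  from ereal_incseq_approx[OF True] obtain q where
    q: "incseq q" "\<And>i. 0 < ereal (q i)" "\<And>i. ereal (q i) < z" "(\<lambda>i. ereal (q i)) \<longlonglongrightarrow> z" by blast
  \<comment> \<open>Dividing \<open>q 0\<close> gives a sequence decreasing to 0 that automatically
    stays below \<open>q n\<close>.\<close>
  define p where "p n = q 0 / Suc n" for n
  have q0: "q 0 \<le> q n" for n using q(1) by (auto simp: incseq_def)
  have p: "0 < p n" "p n \<le> q n" for n
    using q(2)[of 0] q0[of n] by (auto simp: p_def divide_le_eq intro: order_trans mult_left_le)
  have Un: "A = (\<Union>n. A \<inter> {p n<..q n})"
  proof (intro equalityI subsetI)
    fix x assume "x \<in> A"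
    with A have x: "0 < x" "ereal x < z" by auto
    have "p \<longlonglongrightarrow> 0" unfolding p_def by (rule tendsto_divide_0[OF tendsto_const])
        (intro filterlim_at_top_imp_at_infinity filterlim_compose[OF filterlim_real_sequentially filterlim_Suc])
    then have "\<forall>\<^sub>F n in sequentially. p n < x" using x(1) by (rule order_tendstoD)
    moreover have "\<forall>\<^sub>F n in sequentially. ereal x < ereal (q n)" using q(4) x(2) by (rule order_tendstoD)
    ultimately have "\<forall>\<^sub>F n in sequentially. p n < x \<and> x < q n" by eventually_elim auto
    then obtain n where "p n < x" "x < q n" by (auto simp: eventually_sequentially)
    with \<open>x \<in> A\<close> show "x \<in> (\<Union>n. A \<inter> {p n<..q n})" by (auto intro!: exI[of _ n])
  qed auto
  have inc: "incseq (\<lambda>n. A \<inter> {p n<..q n})"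
  proof (rule incseq_SucI)
    fix n
    have "p (Suc n) \<le> p n" "q n \<le> q (Suc n)"
      using q(2)[of 0] incseq_SucD[OF q(1), of n] by (auto simp: p_def intro!: divide_left_mono)
    then show "A \<inter> {p n<..q n} \<subseteq> A \<inter> {p (Suc n)<..q (Suc n)}" by auto
  qed
  have *: "emeasure \<mu> (A \<inter> {p n<..q n}) = emeasure \<nu> (A \<inter> {p n<..q n})" for n
  proof -
    let ?I = "\<lambda>t. indicator {p n<..q n} t :: ennreal"
    have dens: "emeasure (density N ?I) B = emeasure N (B \<inter> {p n<..q n})"
      if "sets N = sets borel" "B \<in> sets borel" for N B
      using that emeasure_restricted[of "{p n<..q n}" N B] by (simp add: Int_commute)
    \<comment> \<open>After restriction to \<open>(p n, q n]\<close> every ray becomes a half-open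
      interval covered by \<open>eq\<close> and \<open>fin\<close>.\<close>
    have "density \<mu> ?I = density \<nu> ?I"
    proof (rule measure_eqI_lessThan)
      fix x :: real
      have I: "{x<..} \<inter> {p n<..q n} = {max x (p n)<..q n}" by auto
      show "emeasure (density \<mu> ?I) {x<..} < \<infinity>"
        "emeasure (density \<mu> ?I) {x<..} = emeasure (density \<nu> ?I) {x<..}"
        using p[of n] q(3)[of n] eq[of "max x (p n)" "q n"] fin[of "max x (p n)" "q n"] sets
        by (cases "max x (p n) \<le> q n"; simp add: dens I)+
    qed (use sets in auto)
    then have "emeasure (density \<mu> ?I) A = emeasure (density \<nu> ?I) A" by simp
    then show ?thesis using A sets by (simp add: dens)
  qed
  have "emeasure \<mu> A = (SUP n. emeasure \<mu> (A \<inter> {p n<..q n}))"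
    by (subst Un, intro SUP_emeasure_incseq[symmetric] inc) (use A sets in auto)
  also have "\<dots> = (SUP n. emeasure \<nu> (A \<inter> {p n<..q n}))" by (simp add: *)
  also have "\<dots> = emeasure \<nu> A"
    by (subst (2) Un, intro SUP_emeasure_incseq inc) (use A sets in auto)
  finally show ?thesis .
qed

section \<open>Laws of hitting times as measures on the real line\<close>

lemma sets_hitting_law [simp, measurable_cong]: "sets (hitting_law M T) = sets borel"
  by (simp add: hitting_law_def)

lemma nn_integral_hitting_law:
  assumes [measurable]: "T \<in> borel_measurable M" "\<phi> \<in> borel_measurable borel"
  shows "(\<integral>\<^sup>+t. \<phi> t \<partial>hitting_law M T) =
    (\<integral>\<^sup>+\<omega>. \<phi> (real_of_ereal (T \<omega>)) * indicator {0<..<\<infinity>} (T \<omega>) \<partial>M)"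
  unfolding hitting_law_def
  by (subst nn_integral_distr; (subst nn_integral_restrict_space)?; (subst nn_integral_distr)?)
    (auto intro!: measurable_restrict_space1)

lemma emeasure_hitting_law:
  assumes [measurable]: "T \<in> borel_measurable M" "A \<in> sets borel" and "A \<subseteq> {0<..}"
  shows "emeasure (hitting_law M T) A = emeasure M {\<omega> \<in> space M. T \<omega> \<in> ereal ` A}"
proof -
  have iff: "y \<in> ereal ` A \<longleftrightarrow> real_of_ereal y \<in> A \<and> y \<in> {0<..<\<infinity>}" for y
    using assms(3) by (cases y) auto
  have "emeasure (hitting_law M T) A = (\<integral>\<^sup>+t. indicator A t \<partial>hitting_law M T)"
    by simp
  also have "\<dots> = (\<integral>\<^sup>+\<omega>. indicator {\<omega> \<in> space M. T \<omega> \<in> ereal ` A} \<omega> \<partial>M)"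
    by (subst nn_integral_hitting_law)
      (auto simp: iff simp del: nn_integral_indicator split: split_indicator intro!: nn_integral_cong)
  also have "\<dots> = emeasure M {\<omega> \<in> space M. T \<omega> \<in> ereal ` A}"
    unfolding iff by (rule nn_integral_indicator) measurable
  finally show ?thesis .
qed

lemma (in prob_space) emeasure_hitting_law_finite:
  assumes "T \<in> borel_measurable M" "A \<in> sets borel" "A \<subseteq> {0<..}"
  shows "emeasure (hitting_law M T) A < \<infinity>"
  unfolding emeasure_hitting_law[OF assms] by (simp add: less_top[symmetric])

section \<open>The density of one hitting law with respect to another\<close>

context markovian_density
begin

abbreviation TX where "TX \<equiv> hitting_time X z g"
abbreviation TW where "TW \<equiv> hitting_time W z g"

text \<open>The value of the weight on the curve. The indicator cuts off the times at which
  \<open>g\<close> carries no information, which makes the function Borel on the whole line.\<close>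

definition stopped_density :: "real \<Rightarrow> real" where
  "stopped_density t = indicator {t. 0 \<le> t \<and> ereal t < z} t * K t (g t)"

lemma stopped_density_measurable [measurable]: "stopped_density \<in> borel_measurable borel"
  using borel_measurable_continuous_on_indicator[OF _ K_continuous[OF X.continuous_g]]
  by (simp add: stopped_density_def[abs_def])

lemma hitting_time_greater_transfer:
  assumes "0 \<le> s" "s \<le> t" "ereal t < z"
  shows "emeasure M {\<omega> \<in> space M. ereal s < TX \<omega>} = emeasure (weighted t) {\<omega> \<in> space M. ereal s < TW \<omega>}"
proof -
  have sz: "ereal s < z" using assms X.Icc_subset[OF _ assms(3), of 0] by auto
  have [measurable]: "(\<lambda>\<omega>. ennreal (K t (W t \<omega>))) \<in> borel_measurable M"
    using assms by (intro measurable_weight) auto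
  have "emeasure M {\<omega> \<in> space M. ereal s < TX \<omega>} = emeasure M {\<omega> \<in> space M. \<forall>u\<in>{0..s}. X u \<omega> \<noteq> g u}"
  proof (rule emeasure_eq_AE)
    show "AE \<omega> in M. \<omega> \<in> {\<omega> \<in> space M. ereal s < TX \<omega>} \<longleftrightarrow>
      \<omega> \<in> {\<omega> \<in> space M. \<forall>u\<in>{0..s}. X u \<omega> \<noteq> g u}"
      using X.start_off_curve by eventually_elim (use X.hitting_time_greater_iff assms(1) sz in blast)
    show "{\<omega> \<in> space M. \<forall>u\<in>{0..s}. X u \<omega> \<noteq> g u} \<in> sets M"
      by (rule X.off_curve_sets) (use sz in auto)
  qed measurable
  also have "\<dots> = emeasure (weighted t) {\<omega> \<in> space M. \<forall>u\<in>{0..s}. W u \<omega> \<noteq> g u}"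
    by (rule off_curve_transfer[OF assms])
  also have "\<dots> = emeasure (weighted t) {\<omega> \<in> space M. ereal s < TW \<omega>}"
  proof (rule emeasure_eq_AE)
    have "AE \<omega> in M. \<omega> \<in> {\<omega> \<in> space M. \<forall>u\<in>{0..s}. W u \<omega> \<noteq> g u} \<longleftrightarrow>
      \<omega> \<in> {\<omega> \<in> space M. ereal s < TW \<omega>}"
      using W.start_off_curve by eventually_elim (use W.hitting_time_greater_iff assms(1) sz in blast)
    then show "AE \<omega> in weighted t. \<omega> \<in> {\<omega> \<in> space M. \<forall>u\<in>{0..s}. W u \<omega> \<noteq> g u} \<longleftrightarrow>
      \<omega> \<in> {\<omega> \<in> space M. ereal s < TW \<omega>}"
      by (subst AE_density) auto
    show "{\<omega> \<in> space M. \<forall>u\<in>{0..s}. W u \<omega> \<noteq> g u} \<in> sets (weighted t)"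
      using W.off_curve_sets[of 0 s] sz by simp
  qed measurable
  finally show ?thesis .
qed

text \<open>Both \<open>T > s\<close> and \<open>T > t\<close> are transferred with the weight at
  time \<open>t\<close>, so their difference is again an event under the single finite measure
  \<open>weighted t\<close>.\<close>

lemma hitting_time_interval_transfer:
  assumes "0 \<le> s" "s \<le> t" "ereal t < z"
  shows "emeasure M {\<omega> \<in> space M. ereal s < TX \<omega> \<and> TX \<omega> \<le> ereal t} =
    (\<integral>\<^sup>+\<omega>. indicator {ereal s<..ereal t} (TW \<omega>) * ennreal (K t (W t \<omega>)) \<partial>M)"
proof -
  interpret weighted: finite_measure "weighted t"
    by (rule finite_weighted) (use assms in auto)
  have D: "{\<omega> \<in> space M. ereal s < T \<omega> \<and> T \<omega> \<le> ereal t} =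
    {\<omega> \<in> space M. ereal s < T \<omega>} - {\<omega> \<in> space M. ereal t < T \<omega>}" for T by auto
  have "emeasure M {\<omega> \<in> space M. ereal s < TX \<omega> \<and> TX \<omega> \<le> ereal t} =
    emeasure M {\<omega> \<in> space M. ereal s < TX \<omega>} - emeasure M {\<omega> \<in> space M. ereal t < TX \<omega>}"
    unfolding D by (rule emeasure_Diff) (use assms in \<open>auto intro: le_less_trans[of "ereal s" "ereal t"]\<close>)
  also have "\<dots> = emeasure (weighted t) {\<omega> \<in> space M. ereal s < TW \<omega>} -
      emeasure (weighted t) {\<omega> \<in> space M. ereal t < TW \<omega>}"
    using assms by (intro arg_cong2[where f = minus] hitting_time_greater_transfer) auto
  also have "\<dots> = emeasure (weighted t) {\<omega> \<in> space M. ereal s < TW \<omega> \<and> TW \<omega> \<le> ereal t}"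
    unfolding D by (rule emeasure_Diff[symmetric])
      (use assms in \<open>auto intro: le_less_trans[of "ereal s" "ereal t"]\<close>)
  also have "\<dots> = (\<integral>\<^sup>+\<omega>. indicator {ereal s<..ereal t} (TW \<omega>) * ennreal (K t (W t \<omega>)) \<partial>M)"
    using assms by (subst emeasure_weighted) (auto simp: indicator_def intro!: nn_integral_cong)
  finally show ?thesis .
qed

text \<open>For \<open>T \<in> (s\<^sub>i, s\<^sub>i\<^sub>+\<^sub>1]\<close> the density may be evaluated at \<open>s\<^sub>i\<^sub>+\<^sub>1\<close>, which avoids optional stopping.\<close>

lemma hitting_time_interval_density:
  assumes "0 \<le> a" "a \<le> b" "ereal b < z"
  shows "emeasure M {\<omega> \<in> space M. ereal a < TX \<omega> \<and> TX \<omega> \<le> ereal b} =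
    (\<integral>\<^sup>+\<omega>. indicator {ereal a<..ereal b} (TW \<omega>) * ennreal (stopped_density (real_of_ereal (TW \<omega>))) \<partial>M)"
proof (cases "a = b")
  case False
  with assms have "a < b" by simp
  define s where "s n i = a + (b - a) * real i / Suc n" for n i :: nat
  define F where "F n \<omega> = (\<Sum>i\<le>n. indicator {ereal (s n i)<..ereal (s n (Suc i))} (TW \<omega>) *
    ennreal (K (s n (Suc i)) (W (s n (Suc i)) \<omega>)))" for n \<omega>
  have s: "a \<le> s n i" "s n i \<le> b" if "i \<le> Suc n" for n i
  proof -
    have "real i / Suc n \<le> 1" using that by simp
    from mult_left_mono[OF this, of "b - a"] \<open>a < b\<close> show "s n i \<le> b" by (simp add: s_def)
    show "a \<le> s n i" using \<open>a < b\<close> by (simp add: s_def)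
  qed
  have sz: "0 \<le> s n i" "ereal (s n i) < z" if "i \<le> Suc n" for n i
    using s[OF that] assms X.Icc_subset[OF assms(1,3)] by auto
  have s_mono: "s n i \<le> s n (Suc i)" for n i
    using \<open>a < b\<close> by (auto simp: s_def intro!: divide_right_mono mult_left_mono)
  \<comment> \<open>Index of the right end point of the piece that contains \<open>t\<close>. The
    ceiling matches pieces that are open on the left and closed on the right.\<close>
  define r where "r n t = nat \<lceil>(t - a) / (b - a) * Suc n\<rceil>" for n :: nat and t
  have s_iff: "s n i < t \<and> t \<le> s n (Suc i) \<longleftrightarrow> Suc i = r n t" for n i t
  proof -
    have "Suc i = r n t \<longleftrightarrow> \<lceil>(t - a) / (b - a) * Suc n\<rceil> = int (Suc i)"
      by (auto simp: r_def)
    also have "\<dots> \<longleftrightarrow> real i < (t - a) / (b - a) * Suc n \<and> (t - a) / (b - a) * Suc n \<le> real (Suc i)"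
      by (simp add: ceiling_eq_iff)
    also have "\<dots> \<longleftrightarrow> s n i < t \<and> t \<le> s n (Suc i)"
      using \<open>a < b\<close> by (simp add: s_def field_simps)
    finally show ?thesis by simp
  qed
  have r_mem: "0 < r n t" "r n t \<le> Suc n" if "a < t" "t \<le> b" for n t
  proof -
    have "0 < (t - a) / (b - a)" "(t - a) / (b - a) \<le> 1" using that \<open>a < b\<close> by auto
    then have "0 < (t - a) / (b - a) * Suc n" "(t - a) / (b - a) * Suc n \<le> Suc n"
      using mult_right_mono[of "(t - a) / (b - a)" 1 "real (Suc n)"] mult_pos_pos[of "(t - a) / (b - a)" "real (Suc n)"]
      by (simp_all only: of_nat_0_less_iff of_nat_0_le_iff mult_1_left zero_less_Suc)
    then show "0 < r n t" "r n t \<le> Suc n" unfolding r_def by (simp, linarith)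
  qed
  have F_on: "F n \<omega> = ennreal (K (s n (r n t)) (W (s n (r n t)) \<omega>))"
    if t: "TW \<omega> = ereal t" "a < t" "t \<le> b" for n \<omega> t
  proof -
    obtain j where j: "r n t = Suc j" "j \<le> n" using r_mem[OF t(2,3), of n] by (cases "r n t") auto
    have "F n \<omega> = (\<Sum>i\<le>n. if i = j then ennreal (K (s n (Suc i)) (W (s n (Suc i)) \<omega>)) else 0)"
      unfolding F_def by (intro sum.cong refl) (use t s_iff[of n _ t] j in \<open>auto simp: indicator_def\<close>)
    then show ?thesis using j by simp
  qed
  have F_off: "F n \<omega> = 0" if "\<not> (ereal a < TW \<omega> \<and> TW \<omega> \<le> ereal b)" for n \<omega>
    unfolding F_def
  proof (intro sum.neutral ballI)
    fix i assume "i \<in> {..n}"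
    then have "ereal a \<le> ereal (s n i)" "ereal (s n (Suc i)) \<le> ereal b" using s by auto
    with that have "\<not> (ereal (s n i) < TW \<omega> \<and> TW \<omega> \<le> ereal (s n (Suc i)))"
      by (meson le_less_trans order_trans)
    then show "indicator {ereal (s n i)<..ereal (s n (Suc i))} (TW \<omega>) *
      ennreal (K (s n (Suc i)) (W (s n (Suc i)) \<omega>)) = 0"
      by (simp add: indicator_def)
  qed
  have s_lim: "(\<lambda>n. s n (r n t)) \<longlonglongrightarrow> t" if t: "a < t" "t \<le> b" for t
  proof (rule real_tendsto_sandwich)
    have *: "t \<le> s n (r n t)" "s n (r n t) \<le> t + (b - a) / Suc n" for n
    proof -
      obtain j where "r n t = Suc j" using r_mem[OF t, of n] by (cases "r n t") auto
      moreover have "s n (Suc j) = s n j + (b - a) / Suc n"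
        unfolding s_def of_nat_Suc[of j] distrib_left add_divide_distrib by simp
      ultimately show "t \<le> s n (r n t)" "s n (r n t) \<le> t + (b - a) / Suc n"
        using s_iff[of n j t] by auto
    qed
    show "\<forall>\<^sub>F n in sequentially. t \<le> s n (r n t)" "\<forall>\<^sub>F n in sequentially. s n (r n t) \<le> t + (b - a) / Suc n"
      using * by auto
    have "(\<lambda>n. (b - a) / Suc n) \<longlonglongrightarrow> 0" by (rule tendsto_divide_0[OF tendsto_const])
        (intro filterlim_at_top_imp_at_infinity filterlim_compose[OF filterlim_real_sequentially filterlim_Suc])
    then show "(\<lambda>n. t + (b - a) / Suc n) \<longlonglongrightarrow> t" using tendsto_add[OF tendsto_const, of _ 0] by fastforce
  qed auto
  \<comment> \<open>The bound is uniform in the state, hence a constant dominates all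
    \<open>F n\<close>.\<close>
  obtain C where C: "\<And>t x. t \<in> {0..b} \<Longrightarrow> K t x \<le> C"
    using K_bounded[of b] assms by (meson order_trans)
  \<comment> \<open>The left-hand side does not depend on \<open>n\<close>, so the integrals of
    \<open>F n\<close> form a constant sequence and their limit is its value.\<close>
  have eq: "emeasure M {\<omega> \<in> space M. ereal a < TX \<omega> \<and> TX \<omega> \<le> ereal b} = (\<integral>\<^sup>+\<omega>. F n \<omega> \<partial>M)" for n
  proof -
    let ?E = "\<lambda>i. {\<omega> \<in> space M. ereal (s n i) < TX \<omega> \<and> TX \<omega> \<le> ereal (s n (Suc i))}"
    have "{\<omega> \<in> space M. ereal a < TX \<omega> \<and> TX \<omega> \<le> ereal b} = (\<Union>i\<le>n. ?E i)"
    proof (intro equalityI subsetI)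
      fix \<omega> assume "\<omega> \<in> {\<omega> \<in> space M. ereal a < TX \<omega> \<and> TX \<omega> \<le> ereal b}"
      then obtain t where t: "TX \<omega> = ereal t" "a < t" "t \<le> b" "\<omega> \<in> space M" by (cases "TX \<omega>") auto
      obtain j where "r n t = Suc j" "j \<le> n" using r_mem[OF t(2,3), of n] by (cases "r n t") auto
      with s_iff[of n j t] t show "\<omega> \<in> (\<Union>i\<le>n. ?E i)" by auto
    next
      fix \<omega> assume "\<omega> \<in> (\<Union>i\<le>n. ?E i)"
      then obtain i where i: "i \<le> n" "\<omega> \<in> space M" "ereal (s n i) < TX \<omega>" "TX \<omega> \<le> ereal (s n (Suc i))"
        by auto
      have "ereal a \<le> ereal (s n i)" "ereal (s n (Suc i)) \<le> ereal b" using s i(1) by auto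
      from le_less_trans[OF this(1) i(3)] order_trans[OF i(4) this(2)] i(2)
      show "\<omega> \<in> {\<omega> \<in> space M. ereal a < TX \<omega> \<and> TX \<omega> \<le> ereal b}" by simp
    qed
    also have "emeasure M \<dots> = (\<Sum>i\<le>n. emeasure M (?E i))"
    proof (rule sum_emeasure[symmetric])
      show "disjoint_family_on ?E {..n}"
        unfolding disjoint_family_on_def
      proof (intro ballI impI, rule ccontr)
        fix i j assume "i \<noteq> j" "?E i \<inter> ?E j \<noteq> {}"
        then obtain \<omega> where w: "\<omega> \<in> ?E i" "\<omega> \<in> ?E j" by auto
        then obtain t where "TX \<omega> = ereal t" by (cases "TX \<omega>") auto
        with w s_iff[of n i t] s_iff[of n j t] \<open>i \<noteq> j\<close> show False by auto
      qed
    qed auto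
    also have "\<dots> = (\<Sum>i\<le>n. \<integral>\<^sup>+\<omega>. indicator {ereal (s n i)<..ereal (s n (Suc i))} (TW \<omega>) *
        ennreal (K (s n (Suc i)) (W (s n (Suc i)) \<omega>)) \<partial>M)"
      by (intro sum.cong refl hitting_time_interval_transfer sz s_mono) auto
    also have "\<dots> = (\<integral>\<^sup>+\<omega>. F n \<omega> \<partial>M)"
      unfolding F_def
    proof (rule nn_integral_sum[symmetric])
      fix i assume "i \<in> {..n}"
      then have [measurable]: "(\<lambda>\<omega>. ennreal (K (s n (Suc i)) (W (s n (Suc i)) \<omega>))) \<in> borel_measurable M"
        by (intro measurable_weight sz) auto
      show "(\<lambda>\<omega>. indicator {ereal (s n i)<..ereal (s n (Suc i))} (TW \<omega>) *
        ennreal (K (s n (Suc i)) (W (s n (Suc i)) \<omega>))) \<in> borel_measurable M" by measurable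
    qed
    finally show ?thesis .
  qed
  \<comment> \<open>The right end points tend to the hitting time, and along a continuous path the
    weights tend to the weight there. At the hitting time \<open>W\<close> equals \<open>g\<close>,
    so the limit depends on the hitting time only.\<close>
  have "(\<lambda>n. \<integral>\<^sup>+\<omega>. F n \<omega> \<partial>M) \<longlonglongrightarrow> (\<integral>\<^sup>+\<omega>. indicator {ereal a<..ereal b} (TW \<omega>) *
      ennreal (stopped_density (real_of_ereal (TW \<omega>))) \<partial>M)"
  proof (rule nn_integral_dominated_convergence[where w = "\<lambda>_. ennreal C"])
    show "F n \<in> borel_measurable M" for n
      unfolding F_def[abs_def]
    proof (rule borel_measurable_sum)
      fix i assume "i \<in> {..n}"
      then have [measurable]: "(\<lambda>\<omega>. ennreal (K (s n (Suc i)) (W (s n (Suc i)) \<omega>))) \<in> borel_measurable M"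
        by (intro measurable_weight sz) auto
      show "(\<lambda>\<omega>. indicator {ereal (s n i)<..ereal (s n (Suc i))} (TW \<omega>) *
        ennreal (K (s n (Suc i)) (W (s n (Suc i)) \<omega>))) \<in> borel_measurable M" by measurable
    qed
    show "(\<integral>\<^sup>+\<omega>. ennreal C \<partial>M) < \<infinity>" by (simp add: X.emeasure_space_1)
    show "AE \<omega> in M. F n \<omega> \<le> ennreal C" for n
    proof (rule AE_I2)
      fix \<omega>
      show "F n \<omega> \<le> ennreal C"
      proof (cases "ereal a < TW \<omega> \<and> TW \<omega> \<le> ereal b")
        case True
        then obtain t where t: "TW \<omega> = ereal t" "a < t" "t \<le> b" by (cases "TW \<omega>") auto
        then show ?thesis unfolding F_on[OF t] using s[OF r_mem(2)[OF t(2,3)], of n] assms(1)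
          by (intro ennreal_leI C) auto
      qed (simp add: F_off)
    qed
    show "AE \<omega> in M. (\<lambda>n. F n \<omega>) \<longlonglongrightarrow> indicator {ereal a<..ereal b} (TW \<omega>) *
      ennreal (stopped_density (real_of_ereal (TW \<omega>)))"
      using W.start_off_curve AE_space
    proof eventually_elim
      fix \<omega> assume w: "W 0 \<omega> \<noteq> g 0" "\<omega> \<in> space M"
      show "(\<lambda>n. F n \<omega>) \<longlonglongrightarrow> indicator {ereal a<..ereal b} (TW \<omega>) *
        ennreal (stopped_density (real_of_ereal (TW \<omega>)))"
      proof (cases "ereal a < TW \<omega> \<and> TW \<omega> \<le> ereal b")
        case True
        then obtain t where t: "TW \<omega> = ereal t" "a < t" "t \<le> b" by (cases "TW \<omega>") auto
        have tz: "ereal t < z" "0 < t" using t assms(1) subsetD[OF X.Icc_subset[OF assms(1,3)], of t] by auto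
        have "(\<lambda>n. K (s n (r n t)) (W (s n (r n t)) \<omega>)) \<longlonglongrightarrow> K t (W t \<omega>)"
          by (rule continuous_on_tendsto_compose[OF K_continuous[OF W.continuous_X[OF w(2)]] s_lim])
            (use t tz sz[OF r_mem(2)[OF t(2,3)]] in auto)
        moreover have "W t \<omega> = g t" by (rule W.on_curve_at_hitting_time[OF w(2,1) t(1) tz(2,1)])
        ultimately show ?thesis
          using t tz by (simp add: F_on[OF t] stopped_density_def indicator_def tendsto_ennrealI)
      next
        case False
        then have "TW \<omega> \<notin> {ereal a<..ereal b}" by auto
        with False show ?thesis by (simp add: F_off)
      qed
    qed
  qed measurable
  with LIMSEQ_unique[OF tendsto_const] show ?thesis unfolding eq[symmetric] by blast
next
  case True
  then have "{\<omega> \<in> space M. ereal a < TX \<omega> \<and> TX \<omega> \<le> ereal b} = {}" "{ereal a<..ereal b} = {}" by auto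
  then show ?thesis by (simp only: emeasure_empty indicator_simps nn_integral_const empty_iff not_False_eq_True mult_zero_left)
qed

text \<open>The random weight has become a function of the hitting time alone, so the interval
  identity passes to the image measures and from there to all Borel sets before
  \<open>z\<close>.\<close>

lemma hitting_law_density:
  assumes A: "A \<in> sets borel" "A \<subseteq> {t. 0 < t \<and> ereal t < z}"
  shows "emeasure (hitting_law M TX) A =
    (\<integral>\<^sup>+t. indicator A t * ennreal (K t (g t)) \<partial>hitting_law M TW)"
proof -
  have dens: "emeasure (density (hitting_law M TW) (\<lambda>t. ennreal (stopped_density t))) B =
    (\<integral>\<^sup>+t. indicator B t * ennreal (stopped_density t) \<partial>hitting_law M TW)" if "B \<in> sets borel" for B
    using that by (subst emeasure_density) (auto simp: mult.commute)
  have "emeasure (hitting_law M TX) A =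
    emeasure (density (hitting_law M TW) (\<lambda>t. ennreal (stopped_density t))) A"
  proof (rule measure_eq_on_subintervals[OF _ _ _ _ A])
    fix a b :: real assume ab: "0 < a" "a \<le> b" "ereal b < z"
    have "emeasure (hitting_law M TX) {a<..b} =
      emeasure M {\<omega> \<in> space M. ereal a < TX \<omega> \<and> TX \<omega> \<le> ereal b}"
    proof (subst emeasure_hitting_law)
      have "y \<in> ereal ` {a<..b} \<longleftrightarrow> ereal a < y \<and> y \<le> ereal b" for y by (cases y) auto
      then show "emeasure M {\<omega> \<in> space M. TX \<omega> \<in> ereal ` {a<..b}} =
        emeasure M {\<omega> \<in> space M. ereal a < TX \<omega> \<and> TX \<omega> \<le> ereal b}" by simp
    qed (use ab in auto)
    also have "\<dots> = (\<integral>\<^sup>+\<omega>. indicator {ereal a<..ereal b} (TW \<omega>) *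
        ennreal (stopped_density (real_of_ereal (TW \<omega>))) \<partial>M)"
      by (rule hitting_time_interval_density) (use ab in auto)
    also have "\<dots> = (\<integral>\<^sup>+t. indicator {a<..b} t * ennreal (stopped_density t) \<partial>hitting_law M TW)"
    proof (subst nn_integral_hitting_law)
      have "indicator {ereal a<..ereal b} y =
        (indicator {a<..b} (real_of_ereal y) * indicator {0<..<\<infinity>} y :: ennreal)" for y
        using ab by (cases y) (auto simp: indicator_def)
      then show "(\<integral>\<^sup>+\<omega>. indicator {ereal a<..ereal b} (TW \<omega>) *
          ennreal (stopped_density (real_of_ereal (TW \<omega>))) \<partial>M) =
        (\<integral>\<^sup>+\<omega>. indicator {a<..b} (real_of_ereal (TW \<omega>)) * ennreal (stopped_density (real_of_ereal (TW \<omega>))) *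
          indicator {0<..<\<infinity>} (TW \<omega>) \<partial>M)" by (simp add: ac_simps)
    qed auto
    finally show "emeasure (hitting_law M TX) {a<..b} =
      emeasure (density (hitting_law M TW) (\<lambda>t. ennreal (stopped_density t))) {a<..b}"
      by (simp add: dens)
    show "emeasure (hitting_law M TX) {a<..b} < \<infinity>"
      by (rule X.emeasure_hitting_law_finite) (use ab in auto)
  qed auto
  also have "\<dots> = (\<integral>\<^sup>+t. indicator A t * ennreal (K t (g t)) \<partial>hitting_law M TW)"
    unfolding dens[OF A(1)] by (intro nn_integral_cong) (use A(2) in \<open>auto simp: indicator_def stopped_density_def\<close>)
  finally show ?thesis .
qed

end

section \<open>The Gaussian change of law\<close>

context standard_brownian_motion
begin

text \<open>The past is a function of the first \<open>n\<close> increments, which are independent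
  of the last one; Fubini then integrates out the last increment. Only the last step must be strict,
  since an increment over an interval of length 0 has no density.\<close>

lemma markov_property:
  fixes \<tau> :: "nat \<Rightarrow> real" and h :: "nat \<Rightarrow> real \<Rightarrow> ennreal" and \<phi> :: "real \<Rightarrow> ennreal"
  assumes \<tau>: "\<tau> 0 = 0" "\<And>i. i < n \<Longrightarrow> \<tau> i \<le> \<tau> (Suc i)" "\<tau> n < \<tau> (Suc n)"
    and h [measurable]: "\<And>i. h i \<in> borel_measurable borel" and \<phi> [measurable]: "\<phi> \<in> borel_measurable borel"
  shows "(\<integral>\<^sup>+\<omega>. (\<Prod>i\<le>n. h i (B (\<tau> i) \<omega>)) * \<phi> (B (\<tau> (Suc n)) \<omega>) \<partial>M) =
    (\<integral>\<^sup>+\<omega>. (\<Prod>i\<le>n. h i (B (\<tau> i) \<omega>)) *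
      (\<integral>\<^sup>+y. normal_density 0 (sqrt (\<tau> (Suc n) - \<tau> n)) y * \<phi> (B (\<tau> n) \<omega> + y) \<partial>lborel) \<partial>M)"
proof -
  let ?I = "\<Pi>\<^sub>M i\<in>{..<n}. (borel :: real measure)"
  define Y where "Y \<omega> = (\<lambda>i\<in>{..<n}. B (\<tau> (Suc i)) \<omega> - B (\<tau> i) \<omega>)" for \<omega>
  let ?J = "\<Pi>\<^sub>M i\<in>{n}. (borel :: real measure)"
  \<comment> \<open>A family with one index rather than a real variable, because independence of
    disjoint blocks of increments is stated for families.\<close>
  define Z where "Z \<omega> = (\<lambda>i\<in>{n}. B (\<tau> (Suc i)) \<omega> - B (\<tau> i) \<omega>)" for \<omega>
  have mono: "\<tau> i \<le> \<tau> (Suc i)" if "i \<le> n" for i using \<tau> that by (cases "i = n") auto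
  have nonneg: "0 \<le> \<tau> i" if "i \<le> Suc n" for i
    using that by (induction i) (use \<tau>(1) mono in \<open>auto intro: order_trans\<close>)
  have "indep_vars (\<lambda>_. borel) (\<lambda>i \<omega>. B (\<tau> (Suc i)) \<omega> - B (\<tau> i) \<omega>) {..<Suc n}"
    by (rule indep_increments) (use \<tau>(1) mono in auto)
  then have indep: "indep_var ?I Y ?J Z"
    unfolding Y_def[abs_def] Z_def[abs_def] by (rule indep_var_restrict) auto
  then have [measurable]: "Y \<in> measurable M ?I" "Z \<in> measurable M ?J"
    by (auto dest: indep_var_rv1 indep_var_rv2)
  have joint: "distr M ?I Y \<Otimes>\<^sub>M distr M ?J Z = distr M (?I \<Otimes>\<^sub>M ?J) (\<lambda>\<omega>. (Y \<omega>, Z \<omega>))"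
    using indep by (simp add: indep_var_distribution_eq)
  have Z_distr: "distributed M lborel (\<lambda>\<omega>. Z \<omega> n) (normal_density 0 (sqrt (\<tau> (Suc n) - \<tau> n)))"
    unfolding Z_def using normal_increments[of "\<tau> n" "\<tau> (Suc n)"] nonneg[of n] \<tau>(3) by simp
  \<comment> \<open>Partial sums recover the positions from the increments, almost surely, because
    \<open>B\<close> starts at 0.\<close>
  define S where "S i y = (\<Sum>j<i. y j)" for i and y :: "nat \<Rightarrow> real"
  have [measurable]: "S i \<in> borel_measurable ?I" if "i \<le> n" for i
    unfolding S_def[abs_def] using that by (intro borel_measurable_sum measurable_component_singleton) auto
  have S_Y: "S i (Y \<omega>) = B (\<tau> i) \<omega>" if "B 0 \<omega> = 0" "i \<le> n" for i \<omega>
    using that(2) by (induction i) (use \<tau>(1) that(1) in \<open>auto simp: S_def Y_def\<close>)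
  define H where "H y = (\<Prod>i\<le>n. h i (S i y))" for y
  have [measurable]: "H \<in> borel_measurable ?I"
    unfolding H_def[abs_def] by (intro borel_measurable_prod_ennreal) measurable
  have [measurable]: "(\<lambda>y. S n y) \<in> borel_measurable ?I" by measurable
  interpret Z: prob_space "distr M ?J Z" by (rule prob_space_distr) fact
  have "(\<integral>\<^sup>+\<omega>. (\<Prod>i\<le>n. h i (B (\<tau> i) \<omega>)) * \<phi> (B (\<tau> (Suc n)) \<omega>) \<partial>M) =
    (\<integral>\<^sup>+\<omega>. H (Y \<omega>) * \<phi> (S n (Y \<omega>) + Z \<omega> n) \<partial>M)"
    using start_at_0 by (intro nn_integral_cong_AE) (auto simp: H_def S_Y Z_def)
  also have "\<dots> = (\<integral>\<^sup>+p. H (fst p) * \<phi> (S n (fst p) + snd p n) \<partial>distr M (?I \<Otimes>\<^sub>M ?J) (\<lambda>\<omega>. (Y \<omega>, Z \<omega>)))"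
    by (subst nn_integral_distr) auto
  also have "\<dots> = (\<integral>\<^sup>+p. H (fst p) * \<phi> (S n (fst p) + snd p n) \<partial>(distr M ?I Y \<Otimes>\<^sub>M distr M ?J Z))"
    by (simp add: joint)
  also have "\<dots> = (\<integral>\<^sup>+y. \<integral>\<^sup>+x. H y * \<phi> (S n y + x n) \<partial>distr M ?J Z \<partial>distr M ?I Y)"
    by (subst Z.nn_integral_fst[symmetric]) auto
  also have "\<dots> = (\<integral>\<^sup>+y. H y * (\<integral>\<^sup>+x. normal_density 0 (sqrt (\<tau> (Suc n) - \<tau> n)) x * \<phi> (S n y + x) \<partial>lborel)
      \<partial>distr M ?I Y)"
  proof (rule nn_integral_cong)
    fix y assume "y \<in> space (distr M ?I Y)"
    have "(\<integral>\<^sup>+x. H y * \<phi> (S n y + x n) \<partial>distr M ?J Z) = (\<integral>\<^sup>+\<omega>. H y * \<phi> (S n y + Z \<omega> n) \<partial>M)"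
      by (subst nn_integral_distr) auto
    also have "\<dots> = (\<integral>\<^sup>+x. normal_density 0 (sqrt (\<tau> (Suc n) - \<tau> n)) x * (H y * \<phi> (S n y + x)) \<partial>lborel)"
      by (rule distributed_nn_integral[OF Z_distr, symmetric]) measurable
    also have "\<dots> = H y * (\<integral>\<^sup>+x. normal_density 0 (sqrt (\<tau> (Suc n) - \<tau> n)) x * \<phi> (S n y + x) \<partial>lborel)"
      by (subst nn_integral_cmult[symmetric]) (auto simp: ac_simps)
    finally show "(\<integral>\<^sup>+x. H y * \<phi> (S n y + x n) \<partial>distr M ?J Z) =
      H y * (\<integral>\<^sup>+x. normal_density 0 (sqrt (\<tau> (Suc n) - \<tau> n)) x * \<phi> (S n y + x) \<partial>lborel)" .
  qed
  also have "\<dots> = (\<integral>\<^sup>+\<omega>. H (Y \<omega>) *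
      (\<integral>\<^sup>+x. normal_density 0 (sqrt (\<tau> (Suc n) - \<tau> n)) x * \<phi> (S n (Y \<omega>) + x) \<partial>lborel) \<partial>M)"
    by (subst nn_integral_distr) auto
  also have "\<dots> = (\<integral>\<^sup>+\<omega>. (\<Prod>i\<le>n. h i (B (\<tau> i) \<omega>)) *
      (\<integral>\<^sup>+x. normal_density 0 (sqrt (\<tau> (Suc n) - \<tau> n)) x * \<phi> (B (\<tau> n) \<omega> + x) \<partial>lborel) \<partial>M)"
    using start_at_0 by (intro nn_integral_cong_AE) (auto simp: H_def S_Y)
  finally show ?thesis .
qed

end

text \<open>The reciprocal of \<open>N_t\<close>. For \<open>t > 0\<close> it is the centred normal
  density of variance \<open>t * (1 + c * t)\<close> at \<open>x\<close>, divided by the one of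
  variance \<open>t\<close>.\<close>

definition girsanov_weight :: "real \<Rightarrow> real \<Rightarrow> real \<Rightarrow> real" where
  "girsanov_weight c t x = exp (c * x\<^sup>2 / (2 * (1 + c * t))) / sqrt (1 + c * t)"

lemma girsanov_weight_nonneg: "0 < 1 + c * t \<Longrightarrow> 0 \<le> girsanov_weight c t x"
  by (simp add: girsanov_weight_def)

text \<open>A Doob transform: up to the factor weight at \<open>t\<close> over weight at
  \<open>s\<close>, the step from \<open>x\<close> to \<open>x + y\<close> has the same density for
  the time-changed process as for Brownian motion. Along a chain of times these factors telescope.
  The absolute value is the Jacobian of the space scaling.\<close>

lemma normal_density_girsanov:
  fixes \<alpha> \<beta> s t x y :: real
  defines "c \<equiv> \<alpha> * \<beta>"
  assumes "\<alpha> \<noteq> 0" "s < t" "0 < 1 + c * s" "0 < 1 + c * t"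
  shows "\<bar>\<alpha> / (1 + c * t)\<bar> *
      normal_density 0 (sqrt (theta \<alpha> \<beta> t - theta \<alpha> \<beta> s)) (\<alpha> * (x + y) / (1 + c * t) - \<alpha> * x / (1 + c * s)) *
      girsanov_weight c s x =
    normal_density 0 (sqrt (t - s)) y * girsanov_weight c t (x + y)"
proof -
  define p q r where "p = 1 + c * s" and "q = 1 + c * t" and "r = t - s"
  have pqr: "0 < p" "0 < q" "0 < r" and cr: "c = (q - p) / r"
    using assms by (auto simp: p_def q_def r_def field_simps)
  have v: "theta \<alpha> \<beta> t - theta \<alpha> \<beta> s = \<alpha>\<^sup>2 * r / (p * q)"
    using pqr unfolding theta_def c_def[symmetric] p_def[symmetric] q_def[symmetric]
    by (simp add: field_simps) (simp add: p_def q_def r_def algebra_simps power2_eq_square)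
  \<comment> \<open>Once \<open>c\<close> is written as \<open>(q - p) / r\<close>, both exponents
    are rational in \<open>p\<close>, \<open>q\<close>, \<open>r\<close>, \<open>x\<close>,
    \<open>y\<close>, and the identity is pure algebra.\<close>
  have e: "- (\<alpha> * (x + y) / q - \<alpha> * x / p)\<^sup>2 / (2 * (\<alpha>\<^sup>2 * r / (p * q))) + c * x\<^sup>2 / (2 * p) =
    - y\<^sup>2 / (2 * r) + c * (x + y)\<^sup>2 / (2 * q)"
    using pqr assms(2) unfolding cr by (simp add: field_simps) algebra
  have f: "\<bar>\<alpha> / q\<bar> * (1 / sqrt (2 * pi * (\<alpha>\<^sup>2 * r / (p * q)))) * (1 / sqrt p) =
    1 / sqrt (2 * pi * r) * (1 / sqrt q)"
    using pqr assms(2) by (simp add: real_sqrt_mult real_sqrt_divide field_simps)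
  have "\<bar>\<alpha> / q\<bar> * normal_density 0 (sqrt (\<alpha>\<^sup>2 * r / (p * q))) (\<alpha> * (x + y) / q - \<alpha> * x / p) *
      (exp (c * x\<^sup>2 / (2 * p)) / sqrt p) =
    (\<bar>\<alpha> / q\<bar> * (1 / sqrt (2 * pi * (\<alpha>\<^sup>2 * r / (p * q)))) * (1 / sqrt p)) *
    exp (- (\<alpha> * (x + y) / q - \<alpha> * x / p)\<^sup>2 / (2 * (\<alpha>\<^sup>2 * r / (p * q))) + c * x\<^sup>2 / (2 * p))"
    using pqr by (simp add: normal_density_def mult_exp_exp)
  also have "\<dots> = normal_density 0 (sqrt r) y * (exp (c * (x + y)\<^sup>2 / (2 * q)) / sqrt q)"
    unfolding e f using pqr by (simp add: normal_density_def mult_exp_exp)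
  finally show ?thesis
    unfolding v girsanov_weight_def p_def[symmetric] q_def[symmetric] r_def[symmetric] .
qed

text \<open>If the time-changed process is at \<open>x\<close> at time \<open>s\<close>, then
  \<open>B\<close> is at \<open>\<alpha> * x / (1 + c * s)\<close> at time
  \<open>theta \<alpha> \<beta> s\<close>. The left-hand side is thus a weighted one-step
  expectation of that process, and a change of variables reduces it to the identity of
  densities.\<close>

lemma transition_girsanov:
  fixes \<alpha> \<beta> s t x :: real and \<phi> :: "real \<Rightarrow> ennreal"
  defines "c \<equiv> \<alpha> * \<beta>"
  assumes \<alpha>: "\<alpha> \<noteq> 0" and st: "s < t" "0 < 1 + c * s" "0 < 1 + c * t"
    and [measurable]: "\<phi> \<in> borel_measurable borel"
  shows "(\<integral>\<^sup>+y. normal_density 0 (sqrt (theta \<alpha> \<beta> t - theta \<alpha> \<beta> s)) y *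
        \<phi> ((1 + c * t) / \<alpha> * (\<alpha> * x / (1 + c * s) + y)) \<partial>lborel) * girsanov_weight c s x =
    (\<integral>\<^sup>+y. normal_density 0 (sqrt (t - s)) y * (\<phi> (x + y) * girsanov_weight c t (x + y)) \<partial>lborel)"
proof -
  let ?n = "normal_density 0 (sqrt (theta \<alpha> \<beta> t - theta \<alpha> \<beta> s))"
  \<comment> \<open>The affine substitution with slope \<open>k\<close> and offset \<open>l\<close>
    is the one under which the new position of the time-changed process becomes
    \<open>x + y\<close>.\<close>
  define k where "k = \<alpha> / (1 + c * t)"
  define l where "l = \<alpha> * x / (1 + c * t) - \<alpha> * x / (1 + c * s)"
  have arg: "l + k * y = \<alpha> * (x + y) / (1 + c * t) - \<alpha> * x / (1 + c * s)" for y
    by (simp add: k_def l_def distrib_left add_divide_distrib)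
  have arg': "(1 + c * t) / \<alpha> * (\<alpha> * x / (1 + c * s) + (l + k * y)) = x + y" for y
    unfolding arg using \<alpha> st by simp
  have ac: "a * (b * p) * w = a * b * w * p" for a b p w :: ennreal
    by (simp add: mult_ac)
  have ac': "a * b * p = a * (p * b)" for a b p :: ennreal
    by (simp add: mult_ac)
  have w_nonneg: "0 \<le> girsanov_weight c s x" using st by (simp add: girsanov_weight_nonneg)
  have k: "k \<noteq> 0" using \<alpha> st by (simp add: k_def)
  have "(\<integral>\<^sup>+y. ?n y * \<phi> ((1 + c * t) / \<alpha> * (\<alpha> * x / (1 + c * s) + y)) \<partial>lborel) =
    \<bar>k\<bar> * (\<integral>\<^sup>+y. ?n (l + k * y) * \<phi> ((1 + c * t) / \<alpha> * (\<alpha> * x / (1 + c * s) + (l + k * y))) \<partial>lborel)"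
    by (rule nn_integral_real_affine[OF _ k]) measurable
  then have "(\<integral>\<^sup>+y. ?n y * \<phi> ((1 + c * t) / \<alpha> * (\<alpha> * x / (1 + c * s) + y)) \<partial>lborel) * girsanov_weight c s x =
    \<bar>k\<bar> * (\<integral>\<^sup>+y. ?n (l + k * y) * \<phi> (x + y) \<partial>lborel) * girsanov_weight c s x"
    unfolding arg' by (rule arg_cong)
  also have "\<dots> =
      (\<integral>\<^sup>+y. ennreal \<bar>k\<bar> * (?n (l + k * y) * \<phi> (x + y)) * ennreal (girsanov_weight c s x) \<partial>lborel)"
    by (subst nn_integral_multc, measurable, subst nn_integral_cmult, measurable)
  also have "\<dots> = (\<integral>\<^sup>+y. ennreal (normal_density 0 (sqrt (t - s)) y * girsanov_weight c t (x + y)) * \<phi> (x + y) \<partial>lborel)"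
  proof (rule nn_integral_cong)
    fix y
    have "\<bar>k\<bar> * ?n (l + k * y) * girsanov_weight c s x =
      normal_density 0 (sqrt (t - s)) y * girsanov_weight c t (x + y)"
      unfolding arg unfolding k_def c_def
      by (rule normal_density_girsanov) (use \<alpha> st in \<open>simp_all add: c_def\<close>)
    moreover have "ennreal (\<bar>k\<bar> * ?n (l + k * y) * girsanov_weight c s x) =
      ennreal \<bar>k\<bar> * ennreal (?n (l + k * y)) * ennreal (girsanov_weight c s x)"
      using w_nonneg by (simp add: ennreal_mult)
    ultimately show "ennreal \<bar>k\<bar> * (?n (l + k * y) * \<phi> (x + y)) * ennreal (girsanov_weight c s x) =
      ennreal (normal_density 0 (sqrt (t - s)) y * girsanov_weight c t (x + y)) * \<phi> (x + y)"
      by (simp only: ac)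
  qed
  also have "\<dots> = (\<integral>\<^sup>+y. normal_density 0 (sqrt (t - s)) y * (\<phi> (x + y) * girsanov_weight c t (x + y)) \<partial>lborel)"
  proof (rule nn_integral_cong)
    fix y
    have "ennreal (normal_density 0 (sqrt (t - s)) y * girsanov_weight c t (x + y)) =
      ennreal (normal_density 0 (sqrt (t - s)) y) * ennreal (girsanov_weight c t (x + y))"
      using st by (simp add: ennreal_mult girsanov_weight_nonneg)
    then show "ennreal (normal_density 0 (sqrt (t - s)) y * girsanov_weight c t (x + y)) * \<phi> (x + y) =
      ennreal (normal_density 0 (sqrt (t - s)) y) * (\<phi> (x + y) * ennreal (girsanov_weight c t (x + y)))"
      by (simp only: ac')
  qed
  finally show ?thesis .
qed

section \<open>Monotonicity of the time change\<close>

lemma affine_pos_mono: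
  fixes c s t :: real
  assumes "0 < 1 + c * t" "0 \<le> s" "s \<le> t"
  shows "0 < 1 + c * s"
proof (cases "0 \<le> c")
  case False
  then have "c * t \<le> c * s" using assms by (intro mult_left_mono_neg) auto
  with assms show ?thesis by simp
qed (use assms in \<open>simp add: add_pos_nonneg\<close>)

lemma theta_diff:
  assumes "1 + \<alpha> * \<beta> * s \<noteq> 0" "1 + \<alpha> * \<beta> * t \<noteq> 0"
  shows "theta \<alpha> \<beta> t - theta \<alpha> \<beta> s = \<alpha>\<^sup>2 * (t - s) / ((1 + \<alpha> * \<beta> * s) * (1 + \<alpha> * \<beta> * t))"
  using assms unfolding theta_def by (simp add: diff_frac_eq) (simp add: algebra_simps)

lemma theta_mono:
  assumes "0 < 1 + \<alpha> * \<beta> * t" "0 \<le> s" "s \<le> t"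
  shows "theta \<alpha> \<beta> s \<le> theta \<alpha> \<beta> t"
proof -
  have "0 \<le> theta \<alpha> \<beta> t - theta \<alpha> \<beta> s"
    using affine_pos_mono[OF assms] assms by (subst theta_diff) auto
  then show ?thesis by simp
qed

lemma theta_strict_mono:
  assumes "0 < 1 + \<alpha> * \<beta> * t" "0 \<le> s" "s < t" "\<alpha> \<noteq> 0"
  shows "theta \<alpha> \<beta> s < theta \<alpha> \<beta> t"
proof -
  have "0 < theta \<alpha> \<beta> t - theta \<alpha> \<beta> s"
    using affine_pos_mono[of "\<alpha> * \<beta>" t s] assms by (subst theta_diff) auto
  then show ?thesis by simp
qed

lemma theta_0 [simp]: "theta \<alpha> \<beta> 0 = 0"
  by (simp add: theta_def)

section \<open>Finite-dimensional laws of the time-changed Brownian motion\<close>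

context standard_brownian_motion
begin

text \<open>This is \<open>S_fun\<close> applied to the path itself, so it differs from the
  transformed curve by a nonzero multiple of the difference between path and curve at time
  \<open>theta \<alpha> \<beta> t\<close>.\<close>

definition time_changed :: "real \<Rightarrow> real \<Rightarrow> real \<Rightarrow> 'a \<Rightarrow> real" where
  "time_changed \<alpha> \<beta> t \<omega> = (1 + \<alpha> * \<beta> * t) / \<alpha> * B (theta \<alpha> \<beta> t) \<omega>"

text \<open>Induction on the number of times. The arbitrary last factor \<open>\<phi>\<close> is
  what the induction needs: the conditional expectation of the final step is again a function of the
  previous position. The Markov property is used forwards for the time-changed process and backwards
  for \<open>B\<close>.\<close>

lemma time_changed_density:
  fixes \<tau> :: "nat \<Rightarrow> real" and h :: "nat \<Rightarrow> real \<Rightarrow> ennreal" and \<phi> :: "real \<Rightarrow> ennreal"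
  assumes \<alpha>: "\<alpha> \<noteq> 0" and \<tau>0: "\<tau> 0 = 0" and \<tau>: "\<And>i. i < n \<Longrightarrow> \<tau> i \<le> \<tau> (Suc i)"
    and pos: "0 < 1 + \<alpha> * \<beta> * \<tau> n"
    and h [measurable]: "\<And>i. h i \<in> borel_measurable borel" and \<phi>: "\<phi> \<in> borel_measurable borel"
  shows "(\<integral>\<^sup>+\<omega>. (\<Prod>i\<le>n. h i (time_changed \<alpha> \<beta> (\<tau> i) \<omega>)) * \<phi> (time_changed \<alpha> \<beta> (\<tau> n) \<omega>) \<partial>M) =
    (\<integral>\<^sup>+\<omega>. (\<Prod>i\<le>n. h i (B (\<tau> i) \<omega>)) *
      (\<phi> (B (\<tau> n) \<omega>) * girsanov_weight (\<alpha> * \<beta>) (\<tau> n) (B (\<tau> n) \<omega>)) \<partial>M)"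
  using \<tau> pos \<phi>
proof (induction n arbitrary: \<phi>)
  case 0
  \<comment> \<open>At time 0 both processes vanish almost surely, and the weight at the origin is
    1.\<close>
  show ?case
    using start_at_0 by (intro nn_integral_cong_AE) (auto simp: \<tau>0 time_changed_def girsanov_weight_def)
next
  case (Suc n)
  note [measurable] = Suc.prems(3)
  have nonneg: "0 \<le> \<tau> i" if "i \<le> Suc n" for i
    using that by (induction i) (use \<tau>0 Suc.prems(1) in \<open>auto intro: order_trans\<close>)
  have le: "\<tau> i \<le> \<tau> (Suc n)" if "i \<le> Suc n" for i
    using that by (induction rule: inc_induct) (use Suc.prems(1) in \<open>auto intro: order_trans\<close>)
  have pos: "0 < 1 + \<alpha> * \<beta> * \<tau> i" if "i \<le> Suc n" for i
    using affine_pos_mono[OF Suc.prems(2) nonneg[OF that] le[OF that]] .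
  have IH: "(\<integral>\<^sup>+\<omega>. (\<Prod>i\<le>n. h i (time_changed \<alpha> \<beta> (\<tau> i) \<omega>)) * \<psi> (time_changed \<alpha> \<beta> (\<tau> n) \<omega>) \<partial>M) =
    (\<integral>\<^sup>+\<omega>. (\<Prod>i\<le>n. h i (B (\<tau> i) \<omega>)) *
      (\<psi> (B (\<tau> n) \<omega>) * girsanov_weight (\<alpha> * \<beta>) (\<tau> n) (B (\<tau> n) \<omega>)) \<partial>M)"
    if "\<psi> \<in> borel_measurable borel" for \<psi>
    using Suc.prems(1) pos[of n] that by (intro Suc.IH) auto
  define \<phi>' where "\<phi>' x = h (Suc n) x * \<phi> x" for x
  have [measurable]: "\<phi>' \<in> borel_measurable borel" unfolding \<phi>'_def[abs_def] by measurable
  \<comment> \<open>Equal times would give a normal law of variance 0; there the last two factors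
    are merged into one instead.\<close>
  show ?case
  proof (cases "\<tau> n = \<tau> (Suc n)")
    case True
    then show ?thesis using IH[of \<phi>'] by (simp add: \<phi>'_def mult.assoc)
  next
    case False
    with Suc.prems(1)[of n] have lt: "\<tau> n < \<tau> (Suc n)" by simp
    let ?c = "\<alpha> * \<beta>"
    let ?n = "normal_density 0 (sqrt (theta \<alpha> \<beta> (\<tau> (Suc n)) - theta \<alpha> \<beta> (\<tau> n)))"
    \<comment> \<open>The conditional expectation of the last factor, as a function of the position
      of the time-changed process at time \<open>\<tau> n\<close>.\<close>
    define \<psi> where "\<psi> x = (\<integral>\<^sup>+y. ?n y * \<phi>' ((1 + ?c * \<tau> (Suc n)) / \<alpha> * (\<alpha> * x / (1 + ?c * \<tau> n) + y)) \<partial>lborel)" for x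
    have [measurable]: "\<psi> \<in> borel_measurable borel" unfolding \<psi>_def[abs_def] by measurable
    have B_eq: "B (theta \<alpha> \<beta> (\<tau> n)) \<omega> = \<alpha> * time_changed \<alpha> \<beta> (\<tau> n) \<omega> / (1 + ?c * \<tau> n)" for \<omega>
      using pos[of n] \<alpha> by (simp add: time_changed_def)
    have "(\<integral>\<^sup>+\<omega>. (\<Prod>i\<le>Suc n. h i (time_changed \<alpha> \<beta> (\<tau> i) \<omega>)) * \<phi> (time_changed \<alpha> \<beta> (\<tau> (Suc n)) \<omega>) \<partial>M) =
      (\<integral>\<^sup>+\<omega>. (\<Prod>i\<le>n. h i ((1 + ?c * \<tau> i) / \<alpha> * B (theta \<alpha> \<beta> (\<tau> i)) \<omega>)) *
        \<phi>' ((1 + ?c * \<tau> (Suc n)) / \<alpha> * B (theta \<alpha> \<beta> (\<tau> (Suc n))) \<omega>) \<partial>M)"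
      by (simp add: \<phi>'_def mult.assoc time_changed_def)
    also have "\<dots> = (\<integral>\<^sup>+\<omega>. (\<Prod>i\<le>n. h i ((1 + ?c * \<tau> i) / \<alpha> * B (theta \<alpha> \<beta> (\<tau> i)) \<omega>)) *
      (\<integral>\<^sup>+y. ?n y * \<phi>' ((1 + ?c * \<tau> (Suc n)) / \<alpha> * (B (theta \<alpha> \<beta> (\<tau> n)) \<omega> + y)) \<partial>lborel) \<partial>M)"
    proof (rule markov_property[where \<tau> = "\<lambda>i. theta \<alpha> \<beta> (\<tau> i)" and h = "\<lambda>i x. h i ((1 + ?c * \<tau> i) / \<alpha> * x)"
        and \<phi> = "\<lambda>x. \<phi>' ((1 + ?c * \<tau> (Suc n)) / \<alpha> * x)"])
      show "theta \<alpha> \<beta> (\<tau> 0) = 0" by (simp add: \<tau>0)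
      show "theta \<alpha> \<beta> (\<tau> i) \<le> theta \<alpha> \<beta> (\<tau> (Suc i))" if "i < n" for i
        using that by (intro theta_mono pos nonneg Suc.prems(1)) auto
      show "theta \<alpha> \<beta> (\<tau> n) < theta \<alpha> \<beta> (\<tau> (Suc n))"
        by (intro theta_strict_mono pos nonneg lt \<alpha>) auto
    qed measurable
    also have "\<dots> = (\<integral>\<^sup>+\<omega>. (\<Prod>i\<le>n. h i (time_changed \<alpha> \<beta> (\<tau> i) \<omega>)) * \<psi> (time_changed \<alpha> \<beta> (\<tau> n) \<omega>) \<partial>M)"
      unfolding \<psi>_def B_eq time_changed_def[symmetric] ..
    also have "\<dots> = (\<integral>\<^sup>+\<omega>. (\<Prod>i\<le>n. h i (B (\<tau> i) \<omega>)) *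
      (\<psi> (B (\<tau> n) \<omega>) * girsanov_weight ?c (\<tau> n) (B (\<tau> n) \<omega>)) \<partial>M)"
      by (rule IH) measurable
    also have "\<dots> = (\<integral>\<^sup>+\<omega>. (\<Prod>i\<le>n. h i (B (\<tau> i) \<omega>)) *
      (\<integral>\<^sup>+y. normal_density 0 (sqrt (\<tau> (Suc n) - \<tau> n)) y *
        (\<phi>' (B (\<tau> n) \<omega> + y) * girsanov_weight ?c (\<tau> (Suc n)) (B (\<tau> n) \<omega> + y)) \<partial>lborel) \<partial>M)"
      unfolding \<psi>_def using pos[of n] pos[of "Suc n"] \<alpha> lt by (subst transition_girsanov) auto
    also have "\<dots> = (\<integral>\<^sup>+\<omega>. (\<Prod>i\<le>n. h i (B (\<tau> i) \<omega>)) *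
      (\<phi>' (B (\<tau> (Suc n)) \<omega>) * girsanov_weight ?c (\<tau> (Suc n)) (B (\<tau> (Suc n)) \<omega>)) \<partial>M)"
    proof (rule markov_property[symmetric])
      show "(\<lambda>x. \<phi>' x * girsanov_weight ?c (\<tau> (Suc n)) x) \<in> borel_measurable borel"
        unfolding girsanov_weight_def by measurable
    qed (use Suc.prems(1) \<tau>0 lt in auto)
    also have "\<dots> = (\<integral>\<^sup>+\<omega>. (\<Prod>i\<le>Suc n. h i (B (\<tau> i) \<omega>)) *
      (\<phi> (B (\<tau> (Suc n)) \<omega>) * girsanov_weight ?c (\<tau> (Suc n)) (B (\<tau> (Suc n)) \<omega>)) \<partial>M)"
      by (simp add: \<phi>'_def mult.assoc)
    finally show ?thesis .
  qed
qed

end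

section \<open>The operator \<open>S\<close>\<close>

lemma less_zeta_iff: "0 \<le> t \<Longrightarrow> ereal t < zeta \<alpha> \<beta> \<longleftrightarrow> 0 < 1 + \<alpha> * \<beta> * t"
proof (cases "\<alpha> * \<beta> < 0")
  case True
  then show ?thesis by (auto simp: zeta_def field_simps)
next
  case False
  moreover assume "0 \<le> t"
  ultimately show ?thesis by (simp add: zeta_def add_pos_nonneg)
qed

lemma lifetime_eq: "lifetime \<alpha> \<beta> = {t. 0 < t \<and> 0 < 1 + \<alpha> * \<beta> * t}"
  unfolding lifetime_def using less_zeta_iff[of _ \<alpha> \<beta>] by (auto dest: less_imp_le)

lemma domain_eq: "{t. 0 \<le> t \<and> ereal t < zeta \<alpha> \<beta>} = {t. 0 \<le> t \<and> 0 < 1 + \<alpha> * \<beta> * t}"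
  using less_zeta_iff[of _ \<alpha> \<beta>] by auto

lemma theta_less_iff:
  assumes "\<alpha> \<noteq> 0" "0 \<le> s" "0 \<le> t" "0 < 1 + \<alpha> * \<beta> * s" "0 < 1 + \<alpha> * \<beta> * t"
  shows "theta \<alpha> \<beta> s < theta \<alpha> \<beta> t \<longleftrightarrow> s < t"
  using theta_strict_mono[of \<alpha> \<beta> t s] theta_mono[of \<alpha> \<beta> s t] assms by (meson not_less)

lemma theta_inverse:
  assumes "\<alpha> \<noteq> 0" "0 < 1 + \<alpha> * \<beta> * t"
  shows "theta \<alpha> \<beta> t / (\<alpha>\<^sup>2 - \<alpha> * \<beta> * theta \<alpha> \<beta> t) = t"
proof -
  have "\<alpha>\<^sup>2 - \<alpha> * \<beta> * theta \<alpha> \<beta> t = \<alpha>\<^sup>2 / (1 + \<alpha> * \<beta> * t)"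
    using assms by (simp add: theta_def field_simps)
  then show ?thesis using assms by (simp add: theta_def)
qed

text \<open>If \<open>\<alpha> * \<beta> > 0\<close>, the infinite lifetime is mapped onto the
  bounded interval up to \<open>\<alpha> / \<beta>\<close>, and the pullback forgets later hits of
  \<open>f\<close>. Otherwise the condition holds for every \<open>u > 0\<close>.\<close>

lemma theta_image:
  assumes "\<alpha> \<noteq> 0"
  shows "theta \<alpha> \<beta> ` lifetime \<alpha> \<beta> = {u. 0 < u \<and> \<alpha> * \<beta> * u < \<alpha>\<^sup>2}"
proof (intro equalityI subsetI)
  fix u assume "u \<in> theta \<alpha> \<beta> ` lifetime \<alpha> \<beta>"
  then obtain t where t: "0 < t" "0 < 1 + \<alpha> * \<beta> * t" "u = theta \<alpha> \<beta> t" by (auto simp: lifetime_eq)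
  have "\<alpha> * \<beta> * u = \<alpha>\<^sup>2 * (\<alpha> * \<beta> * t / (1 + \<alpha> * \<beta> * t))" by (simp add: t(3) theta_def)
  also have "\<dots> < \<alpha>\<^sup>2 * 1" using t(2) assms by (intro mult_strict_left_mono) (auto simp: divide_less_eq)
  finally show "u \<in> {u. 0 < u \<and> \<alpha> * \<beta> * u < \<alpha>\<^sup>2}" using t assms by (auto simp: theta_def)
next
  fix u assume "u \<in> {u. 0 < u \<and> \<alpha> * \<beta> * u < \<alpha>\<^sup>2}"
  then have u: "0 < u" "0 < \<alpha>\<^sup>2 - \<alpha> * \<beta> * u" by auto
  define t where "t = u / (\<alpha>\<^sup>2 - \<alpha> * \<beta> * u)"
  have e: "1 + \<alpha> * \<beta> * t = \<alpha>\<^sup>2 / (\<alpha>\<^sup>2 - \<alpha> * \<beta> * u)" using u by (simp add: t_def field_simps)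
  then have "theta \<alpha> \<beta> t = u" unfolding theta_def using u assms by (simp add: t_def)
  moreover have "t \<in> lifetime \<alpha> \<beta>" unfolding lifetime_eq using u assms e by (simp add: t_def)
  ultimately show "u \<in> theta \<alpha> \<beta> ` lifetime \<alpha> \<beta>" by blast
qed

lemma theta_image_Ioc:
  assumes "\<alpha> \<noteq> 0" "0 \<le> a" "a \<le> b" "0 < 1 + \<alpha> * \<beta> * b"
  shows "theta \<alpha> \<beta> ` {a<..b} = {theta \<alpha> \<beta> a<..theta \<alpha> \<beta> b}"
proof (intro equalityI subsetI)
  fix u assume "u \<in> theta \<alpha> \<beta> ` {a<..b}"
  then obtain t where t: "a < t" "t \<le> b" "u = theta \<alpha> \<beta> t" by auto
  have "0 < 1 + \<alpha> * \<beta> * t" using affine_pos_mono[OF assms(4)] t assms by auto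
  then show "u \<in> {theta \<alpha> \<beta> a<..theta \<alpha> \<beta> b}"
    using t theta_strict_mono[of \<alpha> \<beta> t a] theta_mono[of \<alpha> \<beta> b t] assms by auto
next
  fix u assume u: "u \<in> {theta \<alpha> \<beta> a<..theta \<alpha> \<beta> b}"
  have "0 \<le> theta \<alpha> \<beta> a" using theta_mono[of \<alpha> \<beta> a 0] affine_pos_mono[OF assms(4), of a] assms by auto
  then have "0 < u" using u by auto
  moreover have "0 < b"
    using u theta_strict_mono[of \<alpha> \<beta> b a] assms by (cases "a = b") auto
  moreover have "\<alpha> * \<beta> * u < \<alpha>\<^sup>2"
  proof (cases "0 \<le> \<alpha> * \<beta>")
    case True
    then have "\<alpha> * \<beta> * u \<le> \<alpha> * \<beta> * theta \<alpha> \<beta> b" using u by (intro mult_left_mono) auto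
    moreover have "theta \<alpha> \<beta> b \<in> theta \<alpha> \<beta> ` lifetime \<alpha> \<beta>"
      using \<open>0 < b\<close> assms by (auto simp: lifetime_eq)
    ultimately show ?thesis unfolding theta_image[OF assms(1)] by auto
  next
    case False
    then have "\<alpha> * \<beta> * u < 0" using \<open>0 < u\<close> by (auto intro: mult_neg_pos)
    then show ?thesis using zero_le_power2[of \<alpha>] by linarith
  qed
  ultimately obtain t where t: "t \<in> lifetime \<alpha> \<beta>" "u = theta \<alpha> \<beta> t"
    using theta_image[OF assms(1), of \<beta>] by blast
  then have "a < t" "t \<le> b"
    using u theta_less_iff[of \<alpha> a t \<beta>] theta_less_iff[of \<alpha> b t \<beta>] assms affine_pos_mono[OF assms(4), of a]
    by (auto simp: lifetime_eq not_less[symmetric])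
  then show "u \<in> theta \<alpha> \<beta> ` {a<..b}" using t(2) by auto
qed

text \<open>Injectivity makes the preimage of \<open>A\<close> under the inverse equal to the image
  of \<open>A\<close> under \<open>theta\<close>.\<close>

lemma emeasure_theta_pullback:
  assumes \<alpha>: "\<alpha> \<noteq> 0" and [measurable_cong]: "sets \<mu> = sets borel"
    and A: "A \<in> sets borel" "A \<subseteq> lifetime \<alpha> \<beta>"
  shows "emeasure (theta_pullback \<alpha> \<beta> \<mu>) A = emeasure \<mu> (theta \<alpha> \<beta> ` A)"
proof -
  let ?L = "lifetime \<alpha> \<beta>"
  let ?R = "restrict_space \<mu> (theta \<alpha> \<beta> ` ?L)"
  let ?inv = "the_inv_into ?L (theta \<alpha> \<beta>)"
  have sets_L: "theta \<alpha> \<beta> ` ?L \<in> sets \<mu>" unfolding theta_image[OF \<alpha>] by measurable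
  have inj: "inj_on (theta \<alpha> \<beta>) ?L"
    by (rule inj_on_inverseI[of _ "\<lambda>u. u / (\<alpha>\<^sup>2 - \<alpha> * \<beta> * u)"]) (auto simp: lifetime_eq theta_inverse[OF \<alpha>])
  \<comment> \<open>The abstract inverse agrees on the range with the inverse of a Moebius map,
    which yields its measurability.\<close>
  have inv: "?inv u = u / (\<alpha>\<^sup>2 - \<alpha> * \<beta> * u)" if "u \<in> theta \<alpha> \<beta> ` ?L" for u
    using that the_inv_into_f_f[OF inj] by (auto simp: lifetime_eq theta_inverse[OF \<alpha>])
  have meas: "?inv \<in> measurable ?R borel"
  proof (subst measurable_cong)
    show "(\<lambda>u. u / (\<alpha>\<^sup>2 - \<alpha> * \<beta> * u)) \<in> measurable ?R borel"
      by (rule measurable_restrict_space1) measurable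
  qed (simp add: space_restrict_space inv)
  have "?inv -` A \<inter> space ?R = theta \<alpha> \<beta> ` A"
    using A(2) the_inv_into_f_f[OF inj] sets_eq_imp_space_eq[of \<mu> borel] assms(2)
    by (auto simp: space_restrict_space)
  then have "emeasure (theta_pullback \<alpha> \<beta> \<mu>) A = emeasure ?R (theta \<alpha> \<beta> ` A)"
    unfolding theta_pullback_def using meas A(1) by (simp add: emeasure_distr)
  also have "\<dots> = emeasure \<mu> (theta \<alpha> \<beta> ` A)"
    using sets_L sets.sets_into_space[OF sets_L] A(2) by (subst emeasure_restrict_space) auto
  finally show ?thesis .
qed

text \<open>Equality is available only inside the lifetime, so the measures are compared after
  multiplication by an indicator.\<close>

lemma nn_integral_eq_on_subsets:
  fixes \<phi> :: "'b \<Rightarrow> ennreal"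
  assumes sets: "sets \<mu> = sets N" "sets \<nu> = sets N"
    and eq: "\<And>E. \<lbrakk>E \<in> sets N; E \<subseteq> A\<rbrakk> \<Longrightarrow> emeasure \<mu> E = emeasure \<nu> E"
    and A: "A \<in> sets N" and [measurable]: "\<phi> \<in> borel_measurable N"
  shows "(\<integral>\<^sup>+x. indicator A x * \<phi> x \<partial>\<mu>) = (\<integral>\<^sup>+x. indicator A x * \<phi> x \<partial>\<nu>)"
proof -
  have meas: "\<phi> \<in> borel_measurable \<mu>" "\<phi> \<in> borel_measurable \<nu>" "A \<in> sets \<mu>" "A \<in> sets \<nu>"
    using assms(5) A by (simp_all add: sets cong: measurable_cong_sets)
  have "density \<mu> (indicator A) = density \<nu> (indicator A)"
  proof (rule measure_eqI)
    fix E assume "E \<in> sets (density \<mu> (indicator A))"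
    then show "emeasure (density \<mu> (indicator A)) E = emeasure (density \<nu> (indicator A)) E"
      using A meas(3,4) eq[of "A \<inter> E"] by (simp add: sets emeasure_restricted sets.Int)
  qed (simp add: sets)
  moreover have "(\<integral>\<^sup>+x. indicator A x * \<phi> x \<partial>\<rho>) = (\<integral>\<^sup>+x. \<phi> x \<partial>density \<rho> (indicator A))"
    if "A \<in> sets \<rho>" "\<phi> \<in> borel_measurable \<rho>" for \<rho>
    using that by (subst nn_integral_density) auto
  ultimately show ?thesis using meas by simp
qed

lemma girsanov_weight_inverse:
  "0 < 1 + c * t \<Longrightarrow>
    girsanov_weight c t x * (sqrt (1 + c * t) * exp (- (c / (2 * (1 + c * t))) * x\<^sup>2)) = 1"
  by (simp add: girsanov_weight_def flip: exp_add)

section \<open>The hitting laws for a fixed curve \<open>f\<close>\<close>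

context standard_brownian_motion
begin

context
  fixes f :: "real \<Rightarrow> real" and \<alpha> \<beta> :: real
  assumes continuous_f: "continuous_on {0..} f" and f_0: "f 0 \<noteq> 0" and \<alpha>: "\<alpha> \<noteq> 0"
begin

text \<open>This is \<open>N_t\<close>, with the exponent written as in the theorem.\<close>

definition inverse_weight :: "real \<Rightarrow> real \<Rightarrow> real" where
  "inverse_weight t x = sqrt (1 + \<alpha> * \<beta> * t) * exp (- (\<alpha> * \<beta> / (2 * (1 + \<alpha> * \<beta> * t))) * x\<^sup>2)"

lemma theta_nonneg: "0 \<le> t \<Longrightarrow> 0 < 1 + \<alpha> * \<beta> * t \<Longrightarrow> 0 \<le> theta \<alpha> \<beta> t"
  by (simp add: theta_def)

lemma continuous_theta_compose:
  assumes "continuous_on {0..} h"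
  shows "continuous_on {t. 0 \<le> t \<and> ereal t < zeta \<alpha> \<beta>} (\<lambda>t. (1 + \<alpha> * \<beta> * t) / \<alpha> * h (theta \<alpha> \<beta> t))"
  unfolding domain_eq
proof (intro continuous_intros \<alpha> continuous_on_compose2[OF assms])
  show "continuous_on {t. 0 \<le> t \<and> 0 < 1 + \<alpha> * \<beta> * t} (theta \<alpha> \<beta>)"
    unfolding theta_def[abs_def] by (intro continuous_intros) auto
qed (auto simp: theta_nonneg \<alpha>)

lemma continuous_S_fun: "continuous_on {t. 0 \<le> t \<and> ereal t < zeta \<alpha> \<beta>} (S_fun \<alpha> \<beta> f)"
  unfolding S_fun_def[abs_def] by (rule continuous_theta_compose[OF continuous_f])

lemma S_fun_0: "S_fun \<alpha> \<beta> f 0 = f 0 / \<alpha>"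
  by (simp add: S_fun_def)

lemma process_B_f: "continuous_process M B \<infinity> f"
proof
  show "AE \<omega> in M. B 0 \<omega> \<noteq> f 0" using start_at_0 by eventually_elim (use f_0 in simp)
  show "continuous_on {t. 0 \<le> t \<and> ereal t < \<infinity>} f"
    using continuous_f by (rule continuous_on_subset) auto
  show "continuous_on {t. 0 \<le> t \<and> ereal t < \<infinity>} (\<lambda>t. B t \<omega>)" if "\<omega> \<in> space M" for \<omega>
    using continuous_paths[OF that] by (rule continuous_on_subset) auto
qed (rule random_variable_B)

lemma process_B_S: "continuous_process M B (zeta \<alpha> \<beta>) (S_fun \<alpha> \<beta> f)"
proof
  show "AE \<omega> in M. B 0 \<omega> \<noteq> S_fun \<alpha> \<beta> f 0"
    using start_at_0 by eventually_elim (use f_0 \<alpha> in \<open>simp add: S_fun_0\<close>)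
  show "continuous_on {t. 0 \<le> t \<and> ereal t < zeta \<alpha> \<beta>} (\<lambda>t. B t \<omega>)" if "\<omega> \<in> space M" for \<omega>
    using continuous_paths[OF that] by (rule continuous_on_subset) auto
qed (rule random_variable_B continuous_S_fun; assumption)+

lemma process_time_changed: "continuous_process M (time_changed \<alpha> \<beta>) (zeta \<alpha> \<beta>) (S_fun \<alpha> \<beta> f)"
proof
  show "AE \<omega> in M. time_changed \<alpha> \<beta> 0 \<omega> \<noteq> S_fun \<alpha> \<beta> f 0"
    using start_at_0 by eventually_elim (use f_0 \<alpha> in \<open>simp add: S_fun_0 time_changed_def\<close>)
  show "continuous_on {t. 0 \<le> t \<and> ereal t < zeta \<alpha> \<beta>} (\<lambda>t. time_changed \<alpha> \<beta> t \<omega>)" if "\<omega> \<in> space M" for \<omega>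
    unfolding time_changed_def by (rule continuous_theta_compose[OF continuous_paths[OF that]])
  show "random_variable borel (time_changed \<alpha> \<beta> t)" if "0 \<le> t" "ereal t < zeta \<alpha> \<beta>" for t
  proof -
    have [measurable]: "random_variable borel (B (theta \<alpha> \<beta> t))"
      using that by (intro random_variable_B theta_nonneg) (auto simp: less_zeta_iff)
    show ?thesis unfolding time_changed_def[abs_def] by measurable
  qed
qed (rule continuous_S_fun)

lemma continuous_inverse_weight:
  "continuous_on {t. 0 \<le> t \<and> ereal t < zeta \<alpha> \<beta>} x \<Longrightarrow>
    continuous_on {t. 0 \<le> t \<and> ereal t < zeta \<alpha> \<beta>} (\<lambda>t. inverse_weight t (x t))"
  unfolding domain_eq inverse_weight_def by (intro continuous_intros) auto

lemma weights_inverse: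
  assumes "0 \<le> t" "ereal t < zeta \<alpha> \<beta>"
  shows "ennreal (girsanov_weight (\<alpha> * \<beta>) t x) * ennreal (inverse_weight t x) = 1"
proof -
  have pos: "0 < 1 + \<alpha> * \<beta> * t" using assms by (simp add: less_zeta_iff)
  have "girsanov_weight (\<alpha> * \<beta>) t x * inverse_weight t x = 1"
    unfolding inverse_weight_def by (rule girsanov_weight_inverse[OF pos])
  moreover have "0 \<le> inverse_weight t x" using pos by (simp add: inverse_weight_def)
  ultimately show ?thesis
    using girsanov_weight_nonneg[OF pos] by (simp flip: ennreal_mult)
qed

lemma time_changed_density_zeta:
  fixes \<tau> :: "nat \<Rightarrow> real" and h :: "nat \<Rightarrow> real \<Rightarrow> ennreal"
  assumes "\<tau> 0 = 0" "\<And>i. i < n \<Longrightarrow> \<tau> i \<le> \<tau> (Suc i)" "ereal (\<tau> n) < zeta \<alpha> \<beta>"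
    and "\<And>i. h i \<in> borel_measurable borel" "\<phi> \<in> borel_measurable borel"
  shows "(\<integral>\<^sup>+\<omega>. (\<Prod>i\<le>n. h i (time_changed \<alpha> \<beta> (\<tau> i) \<omega>)) * \<phi> (time_changed \<alpha> \<beta> (\<tau> n) \<omega>) \<partial>M) =
    (\<integral>\<^sup>+\<omega>. (\<Prod>i\<le>n. h i (B (\<tau> i) \<omega>)) *
      (\<phi> (B (\<tau> n) \<omega>) * girsanov_weight (\<alpha> * \<beta>) (\<tau> n) (B (\<tau> n) \<omega>)) \<partial>M)"
proof (rule time_changed_density[OF \<alpha>])
  have "0 \<le> \<tau> i" if "i \<le> n" for i
    using that by (induction i) (use assms(1,2) in \<open>auto intro: order_trans\<close>)
  then show "0 < 1 + \<alpha> * \<beta> * \<tau> n" using assms(3) by (simp add: less_zeta_iff)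
qed (use assms in auto)

text \<open>For this sign the exponential is at most 1 and the square root is bounded on
  \<open>[0, b]\<close>. The law of \<open>B\<close> is expressed through the time-changed process
  by taking \<open>inverse_weight\<close> as the last factor, which cancels the weight produced by
  \<open>time_changed_density\<close>.\<close>

lemma density_B_time_changed:
  assumes "0 \<le> \<alpha> * \<beta>"
  shows "markovian_density M B (time_changed \<alpha> \<beta>) (zeta \<alpha> \<beta>) (S_fun \<alpha> \<beta> f) inverse_weight"
proof (intro markovian_density.intro process_B_S process_time_changed markovian_density_axioms.intro)
  show "inverse_weight t \<in> borel_measurable borel" for t
    unfolding inverse_weight_def[abs_def] by measurable
  show "0 \<le> inverse_weight t x" if "0 \<le> t" "ereal t < zeta \<alpha> \<beta>" for t x
    using that by (simp add: inverse_weight_def less_zeta_iff)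
  show "\<exists>C. \<forall>t\<in>{0..b}. \<forall>x. inverse_weight t x \<le> C" for b
  proof (intro exI ballI allI)
    fix t x assume "t \<in> {0..b}"
    then have "\<alpha> * \<beta> * t \<le> \<alpha> * \<beta> * b" "0 \<le> \<alpha> * \<beta> * t" using assms by (auto intro: mult_left_mono)
    then have "inverse_weight t x \<le> sqrt (1 + \<alpha> * \<beta> * b) * 1"
      unfolding inverse_weight_def by (intro mult_mono) (use assms in auto)
    then show "inverse_weight t x \<le> sqrt (1 + \<alpha> * \<beta> * b)" by simp
  qed
  fix \<tau> :: "nat \<Rightarrow> real" and n and h :: "nat \<Rightarrow> real \<Rightarrow> ennreal"
  assume *: "\<tau> 0 = 0" "\<And>i. i < n \<Longrightarrow> \<tau> i \<le> \<tau> (Suc i)" "ereal (\<tau> n) < zeta \<alpha> \<beta>"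
    "\<And>i. h i \<in> borel_measurable borel"
  have "0 \<le> \<tau> i" if "i \<le> n" for i
    using that by (induction i) (use *(1,2) in \<open>auto intro: order_trans\<close>)
  then have one: "ennreal (inverse_weight (\<tau> n) x) * ennreal (girsanov_weight (\<alpha> * \<beta>) (\<tau> n) x) = 1" for x
    using weights_inverse[of "\<tau> n" x] *(3) by (simp add: mult.commute)
  have "(\<integral>\<^sup>+\<omega>. (\<Prod>i\<le>n. h i (time_changed \<alpha> \<beta> (\<tau> i) \<omega>)) * inverse_weight (\<tau> n) (time_changed \<alpha> \<beta> (\<tau> n) \<omega>) \<partial>M) =
    (\<integral>\<^sup>+\<omega>. (\<Prod>i\<le>n. h i (B (\<tau> i) \<omega>)) *
      (ennreal (inverse_weight (\<tau> n) (B (\<tau> n) \<omega>)) *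
        ennreal (girsanov_weight (\<alpha> * \<beta>) (\<tau> n) (B (\<tau> n) \<omega>))) \<partial>M)"
    by (rule time_changed_density_zeta) (use * in \<open>auto simp: inverse_weight_def\<close>)
  then show "(\<integral>\<^sup>+\<omega>. (\<Prod>i\<le>n. h i (B (\<tau> i) \<omega>)) \<partial>M) =
    (\<integral>\<^sup>+\<omega>. (\<Prod>i\<le>n. h i (time_changed \<alpha> \<beta> (\<tau> i) \<omega>)) * inverse_weight (\<tau> n) (time_changed \<alpha> \<beta> (\<tau> n) \<omega>) \<partial>M)"
    by (simp add: one)
qed (rule continuous_inverse_weight)

text \<open>For this sign the exponential is again at most 1, and
  \<open>1 + \<alpha> * \<beta> * t\<close> is bounded below by its value at \<open>b\<close>, which
  is positive because \<open>b\<close> lies before \<open>zeta\<close>.\<close>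

lemma density_time_changed_B:
  assumes "\<alpha> * \<beta> \<le> 0"
  shows "markovian_density M (time_changed \<alpha> \<beta>) B (zeta \<alpha> \<beta>) (S_fun \<alpha> \<beta> f) (girsanov_weight (\<alpha> * \<beta>))"
proof (intro markovian_density.intro process_B_S process_time_changed markovian_density_axioms.intro)
  show "girsanov_weight (\<alpha> * \<beta>) t \<in> borel_measurable borel" for t
    unfolding girsanov_weight_def[abs_def] by measurable
  show "0 \<le> girsanov_weight (\<alpha> * \<beta>) t x" if "0 \<le> t" "ereal t < zeta \<alpha> \<beta>" for t x
    using that by (simp add: girsanov_weight_nonneg less_zeta_iff)
  show "continuous_on {t. 0 \<le> t \<and> ereal t < zeta \<alpha> \<beta>} (\<lambda>t. girsanov_weight (\<alpha> * \<beta>) t (x t))"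
    if "continuous_on {t. 0 \<le> t \<and> ereal t < zeta \<alpha> \<beta>} x" for x
    using that unfolding domain_eq girsanov_weight_def by (intro continuous_intros) auto
  show "\<exists>C. \<forall>t\<in>{0..b}. \<forall>x. girsanov_weight (\<alpha> * \<beta>) t x \<le> C" if "0 \<le> b" "ereal b < zeta \<alpha> \<beta>" for b
  proof (intro exI ballI allI)
    fix t x assume "t \<in> {0..b}"
    then have "\<alpha> * \<beta> * b \<le> \<alpha> * \<beta> * t" using assms by (auto intro: mult_left_mono_neg)
    moreover have "0 < 1 + \<alpha> * \<beta> * b" using that by (simp add: less_zeta_iff)
    moreover have "\<alpha> * \<beta> * x\<^sup>2 \<le> 0" using assms by (simp add: mult_nonpos_nonneg)
    ultimately show "girsanov_weight (\<alpha> * \<beta>) t x \<le> 1 / sqrt (1 + \<alpha> * \<beta> * b)"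
      unfolding girsanov_weight_def by (intro frac_le) (auto simp: divide_le_0_iff)
  qed
  fix \<tau> :: "nat \<Rightarrow> real" and n and h :: "nat \<Rightarrow> real \<Rightarrow> ennreal"
  assume *: "\<tau> 0 = 0" "\<And>i. i < n \<Longrightarrow> \<tau> i \<le> \<tau> (Suc i)" "ereal (\<tau> n) < zeta \<alpha> \<beta>"
    "\<And>i. h i \<in> borel_measurable borel"
  show "(\<integral>\<^sup>+\<omega>. (\<Prod>i\<le>n. h i (time_changed \<alpha> \<beta> (\<tau> i) \<omega>)) \<partial>M) =
    (\<integral>\<^sup>+\<omega>. (\<Prod>i\<le>n. h i (B (\<tau> i) \<omega>)) * girsanov_weight (\<alpha> * \<beta>) (\<tau> n) (B (\<tau> n) \<omega>) \<partial>M)"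
    using time_changed_density_zeta[OF *, of "\<lambda>_. 1"] by simp
qed

abbreviation law_B where "law_B \<equiv> hitting_law M (hitting_time B (zeta \<alpha> \<beta>) (S_fun \<alpha> \<beta> f))"
abbreviation law_tc where
  "law_tc \<equiv> hitting_law M (hitting_time (time_changed \<alpha> \<beta>) (zeta \<alpha> \<beta>) (S_fun \<alpha> \<beta> f))"

text \<open>Kept apart from \<open>stopped_density\<close>, whose meaning changes with the direction
  of the transfer; this one is \<open>N_t\<close> on the curve for either sign.\<close>

definition stopped_weight :: "real \<Rightarrow> real" where
  "stopped_weight t = indicator {t. 0 \<le> t \<and> ereal t < zeta \<alpha> \<beta>} t * inverse_weight t (S_fun \<alpha> \<beta> f t)"

lemma stopped_weight_measurable [measurable]: "stopped_weight \<in> borel_measurable borel"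
  using borel_measurable_continuous_on_indicator[OF _ continuous_inverse_weight[OF continuous_S_fun]]
  by (simp add: stopped_weight_def[abs_def])

lemma law_B_density:
  assumes A: "A \<in> sets borel" "A \<subseteq> lifetime \<alpha> \<beta>"
  shows "emeasure law_B A = (\<integral>\<^sup>+t. indicator A t * ennreal (stopped_weight t) \<partial>law_tc)"
proof (cases "0 \<le> \<alpha> * \<beta>")
  case True
  then interpret markovian_density M B "time_changed \<alpha> \<beta>" "zeta \<alpha> \<beta>" "S_fun \<alpha> \<beta> f" inverse_weight
    by (rule density_B_time_changed)
  show ?thesis
    unfolding hitting_law_density[OF A[unfolded lifetime_def]]
    by (intro nn_integral_cong) (use A(2) in \<open>auto simp: stopped_weight_def lifetime_def indicator_def\<close>)
next
  case False
  then interpret markovian_density M "time_changed \<alpha> \<beta>" B "zeta \<alpha> \<beta>" "S_fun \<alpha> \<beta> f" "girsanov_weight (\<alpha> * \<beta>)"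
    by (intro density_time_changed_B) simp
  \<comment> \<open>Here the transfer yields the law of the time-changed hitting time in terms of
    that of \<open>B\<close>. It is inverted by integrating \<open>stopped_weight\<close>, since the
    two weights have product 1 on the lifetime.\<close>
  let ?d = "density law_B (\<lambda>t. ennreal (stopped_density t))"
  have "(\<integral>\<^sup>+t. indicator A t * ennreal (stopped_weight t) \<partial>law_tc) =
    (\<integral>\<^sup>+t. indicator A t * ennreal (stopped_weight t) \<partial>?d)"
  proof (rule nn_integral_eq_on_subsets[where N = borel])
    fix E :: "real set" assume E: "E \<in> sets borel" "E \<subseteq> A"
    then have "emeasure law_tc E = (\<integral>\<^sup>+t. indicator E t * ennreal (girsanov_weight (\<alpha> * \<beta>) t (S_fun \<alpha> \<beta> f t)) \<partial>law_B)"
      using A by (intro hitting_law_density) (auto simp: lifetime_def)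
    also have "\<dots> = (\<integral>\<^sup>+t. ennreal (stopped_density t) * indicator E t \<partial>law_B)"
      by (intro nn_integral_cong) (use A(2) E in \<open>auto simp: stopped_density_def lifetime_def indicator_def\<close>)
    also have "\<dots> = emeasure ?d E" using E by (subst emeasure_density) auto
    finally show "emeasure law_tc E = emeasure ?d E" .
  qed (use A in auto)
  also have "\<dots> = (\<integral>\<^sup>+t. ennreal (stopped_density t) * (indicator A t * ennreal (stopped_weight t)) \<partial>law_B)"
    using A by (subst nn_integral_density) auto
  also have "\<dots> = (\<integral>\<^sup>+t. indicator A t \<partial>law_B)"
    using A(2) weights_inverse
    by (intro nn_integral_cong)
      (auto simp: stopped_density_def stopped_weight_def lifetime_def indicator_def)
  also have "\<dots> = emeasure law_B A" using A by simp
  finally show ?thesis ..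
qed

text \<open>\<open>theta\<close> is an increasing bijection from \<open>(0, s]\<close> onto
  \<open>(0, theta s]\<close>, so one process is off its curve up to \<open>s\<close> exactly when
  the other is up to \<open>theta s\<close>. Comparing the events \<open>T > s\<close> avoids
  computing with the infima themselves.\<close>

lemma law_time_changed:
  assumes A: "A \<in> sets borel" "A \<subseteq> lifetime \<alpha> \<beta>"
  shows "emeasure law_tc A = emeasure (theta_pullback \<alpha> \<beta> (hitting_law M (hitting_time B \<infinity> f))) A"
proof -
  interpret tc: continuous_process M "time_changed \<alpha> \<beta>" "zeta \<alpha> \<beta>" "S_fun \<alpha> \<beta> f"
    by (rule process_time_changed)
  interpret Bf: continuous_process M B \<infinity> f by (rule process_B_f)
  let ?X = "time_changed \<alpha> \<beta>" and ?g = "S_fun \<alpha> \<beta> f"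
  let ?TX = "hitting_time ?X (zeta \<alpha> \<beta>) ?g" and ?TB = "hitting_time B \<infinity> f"
  have greater: "AE \<omega> in M. ereal s < ?TX \<omega> \<longleftrightarrow> ereal (theta \<alpha> \<beta> s) < ?TB \<omega>"
    if s: "0 \<le> s" "0 < 1 + \<alpha> * \<beta> * s" for s
    using tc.start_off_curve Bf.start_off_curve AE_space
  proof eventually_elim
    fix \<omega> assume w: "?X 0 \<omega> \<noteq> ?g 0" "B 0 \<omega> \<noteq> f 0" "\<omega> \<in> space M"
    have iff: "?X t \<omega> \<noteq> ?g t \<longleftrightarrow> B (theta \<alpha> \<beta> t) \<omega> \<noteq> f (theta \<alpha> \<beta> t)" if "0 < 1 + \<alpha> * \<beta> * t" for t
      using that \<alpha> by (simp add: time_changed_def S_fun_def)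
    have image: "theta \<alpha> \<beta> ` {0<..s} = {0<..theta \<alpha> \<beta> s}"
      using theta_image_Ioc[OF \<alpha> _ s] by simp
    have "ereal s < ?TX \<omega> \<longleftrightarrow> (\<forall>t\<in>{0..s}. ?X t \<omega> \<noteq> ?g t)"
      using s by (intro tc.hitting_time_greater_iff w) (auto simp: less_zeta_iff)
    \<comment> \<open>Time 0 is dropped to apply the image of a half-open interval and restored
      afterwards; neither process starts on its curve.\<close>
    also have "\<dots> \<longleftrightarrow> (\<forall>t\<in>{0<..s}. ?X t \<omega> \<noteq> ?g t)"
      using w(1) by (auto simp: less_le)
    also have "\<dots> \<longleftrightarrow> (\<forall>t\<in>{0<..s}. B (theta \<alpha> \<beta> t) \<omega> \<noteq> f (theta \<alpha> \<beta> t))"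
      using iff affine_pos_mono[OF s(2)] by auto
    also have "\<dots> \<longleftrightarrow> (\<forall>u\<in>{0<..theta \<alpha> \<beta> s}. B u \<omega> \<noteq> f u)"
      unfolding image[symmetric] by simp
    also have "\<dots> \<longleftrightarrow> (\<forall>u\<in>{0..theta \<alpha> \<beta> s}. B u \<omega> \<noteq> f u)"
      using w(2) by (auto simp: less_le)
    also have "\<dots> \<longleftrightarrow> ereal (theta \<alpha> \<beta> s) < ?TB \<omega>"
      using s by (intro Bf.hitting_time_greater_iff[symmetric] w theta_nonneg) auto
    finally show "ereal s < ?TX \<omega> \<longleftrightarrow> ereal (theta \<alpha> \<beta> s) < ?TB \<omega>" .
  qed
  show ?thesis
  proof (rule measure_eq_on_subintervals[OF _ _ _ _ A[unfolded lifetime_def]])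
    fix a b :: real assume ab: "0 < a" "a \<le> b" "ereal b < zeta \<alpha> \<beta>"
    then have b: "0 < 1 + \<alpha> * \<beta> * b" by (simp add: less_zeta_iff)
    have a: "0 < 1 + \<alpha> * \<beta> * a" using affine_pos_mono[OF b] ab by auto
    have L: "{a<..b} \<subseteq> lifetime \<alpha> \<beta>"
      using ab affine_pos_mono[OF b] by (auto simp: lifetime_eq)
    have Ioc: "{\<omega> \<in> space M. T \<omega> \<in> ereal ` {p<..q}} = {\<omega> \<in> space M. ereal p < T \<omega> \<and> \<not> ereal q < T \<omega>}"
      for p q :: real and T :: "'a \<Rightarrow> ereal"
    proof -
      have "y \<in> ereal ` {p<..q} \<longleftrightarrow> ereal p < y \<and> \<not> ereal q < y" for y by (cases y) auto
      then show ?thesis by simp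
    qed
    have pos: "0 \<le> theta \<alpha> \<beta> a" using ab a by (intro theta_nonneg) auto
    have "emeasure law_tc {a<..b} = emeasure M {\<omega> \<in> space M. ereal a < ?TX \<omega> \<and> \<not> ereal b < ?TX \<omega>}"
      unfolding Ioc[symmetric] using ab by (intro emeasure_hitting_law) auto
    also have "\<dots> = emeasure M {\<omega> \<in> space M. ereal (theta \<alpha> \<beta> a) < ?TB \<omega> \<and> \<not> ereal (theta \<alpha> \<beta> b) < ?TB \<omega>}"
    proof (rule emeasure_eq_AE)
      show "AE \<omega> in M. \<omega> \<in> {\<omega> \<in> space M. ereal a < ?TX \<omega> \<and> \<not> ereal b < ?TX \<omega>} \<longleftrightarrow>
        \<omega> \<in> {\<omega> \<in> space M. ereal (theta \<alpha> \<beta> a) < ?TB \<omega> \<and> \<not> ereal (theta \<alpha> \<beta> b) < ?TB \<omega>}"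
        using greater[of a] greater[of b] ab a b by auto
    qed measurable
    also have "\<dots> = emeasure (hitting_law M ?TB) {theta \<alpha> \<beta> a<..theta \<alpha> \<beta> b}"
      unfolding Ioc[symmetric] using pos by (intro emeasure_hitting_law[symmetric]) auto
    also have "\<dots> = emeasure (theta_pullback \<alpha> \<beta> (hitting_law M ?TB)) {a<..b}"
      using ab b L \<alpha> by (simp add: emeasure_theta_pullback theta_image_Ioc)
    finally show "emeasure law_tc {a<..b} = emeasure (theta_pullback \<alpha> \<beta> (hitting_law M ?TB)) {a<..b}" .
    show "emeasure law_tc {a<..b} < \<infinity>"
      using ab by (intro emeasure_hitting_law_finite) auto
  qed (auto simp: theta_pullback_def)
qed

lemma law_B_pullback:
  assumes A: "A \<in> sets borel" "A \<subseteq> lifetime \<alpha> \<beta>"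
  shows "emeasure law_B A = (\<integral>\<^sup>+t. indicator A t * ennreal (stopped_weight t)
    \<partial>theta_pullback \<alpha> \<beta> (hitting_law M (hitting_time B \<infinity> f)))"
  unfolding law_B_density[OF A]
proof (rule nn_integral_eq_on_subsets[where N = borel])
  show "emeasure law_tc E = emeasure (theta_pullback \<alpha> \<beta> (hitting_law M (hitting_time B \<infinity> f))) E"
    if "E \<in> sets borel" "E \<subseteq> A" for E
    using that A by (intro law_time_changed) auto
qed (use A in \<open>auto simp: theta_pullback_def\<close>)

text \<open>On \<open>A\<close> the weight \<open>w\<close> of \<open>S_measure\<close> times
  \<open>G\<close> equals the nonnegative \<open>k\<close>, whose integral is the finite mass of the
  law. Integrability and the value of the signed integral both follow.\<close>

lemma law_B_signed:
  fixes A :: "real set"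
  defines "\<mu> \<equiv> hitting_law M (hitting_time B \<infinity> f)"
    and "G \<equiv> \<lambda>t. \<alpha> ^ 3 * (1 + \<alpha> * \<beta> * t) powr (- 5 / 2)
      * exp (- (\<alpha> * \<beta> / (2 * (1 + \<alpha> * \<beta> * t))) * (S_fun \<alpha> \<beta> f t)\<^sup>2)"
  assumes A: "A \<in> sets borel" "A \<subseteq> lifetime \<alpha> \<beta>"
  shows "signed_set_integrable (S_measure \<alpha> \<beta> \<mu>) A G \<and>
    measure law_B A = signed_set_integral (S_measure \<alpha> \<beta> \<mu>) A G"
proof -
  let ?\<pi> = "theta_pullback \<alpha> \<beta> \<mu>"
  let ?D = "{t. 0 \<le> t \<and> ereal t < zeta \<alpha> \<beta>}"
  define w where "w t = (1 + \<alpha> * \<beta> * t) ^ 3 / \<alpha> ^ 3" for t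
  define k where "k t = indicator A t * stopped_weight t" for t
  note [measurable] = A(1)
  have [measurable_cong]: "sets ?\<pi> = sets borel" by (simp add: theta_pullback_def)
  have [measurable]: "w \<in> borel_measurable borel" unfolding w_def[abs_def] by measurable
  have [measurable]: "k \<in> borel_measurable borel" unfolding k_def[abs_def] by measurable
  have k_nonneg: "0 \<le> k t" for t
    by (auto simp: k_def stopped_weight_def inverse_weight_def indicator_def less_zeta_iff)
  have nn: "(\<integral>\<^sup>+t. ennreal (k t) \<partial>?\<pi>) = emeasure law_B A"
    unfolding law_B_pullback[OF A] \<mu>_def
    by (intro nn_integral_cong) (auto simp: k_def indicator_def)
  interpret BS: continuous_process M B "zeta \<alpha> \<beta>" "S_fun \<alpha> \<beta> f" by (rule process_B_S)
  have fin: "emeasure law_B A < \<infinity>"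
    using A by (intro emeasure_hitting_law_finite) (auto simp: lifetime_def)
  have k_int: "integrable ?\<pi> k"
    using k_nonneg nn fin by (intro integrableI_nonneg) auto
  have measure_eq: "measure law_B A = (\<integral>t. k t \<partial>?\<pi>)"
    using k_nonneg nn by (simp add: measure_def integral_eq_nn_integral)
  have cont: "continuous_on ?D G"
    unfolding G_def using continuous_S_fun unfolding domain_eq by (intro continuous_intros) auto
  have G_meas [measurable]: "(\<lambda>t. indicator A t * G t) \<in> borel_measurable borel"
  proof -
    have "A \<subseteq> ?D" using A(2) by (auto simp: lifetime_def)
    from borel_measurable_continuous_on_indicator[OF A(1) continuous_on_subset[OF cont this]]
    show ?thesis by simp
  qed
  have wG: "w t * G t = k t" and w_sgn: "0 < w t * \<alpha>" if "t \<in> A" for t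
  proof -
    have t: "0 < t" "0 < 1 + \<alpha> * \<beta> * t" using that A(2) by (auto simp: lifetime_eq)
    define p where "p = 1 + \<alpha> * \<beta> * t"
    \<comment> \<open>The sum 3 - 5/2 = 1/2 produces the square root in
      \<open>inverse_weight\<close>.\<close>
    have "p powr (- 5 / 2) * p ^ 3 = p powr (- 5 / 2) * p powr 3"
      using t by (simp add: p_def)
    also have "\<dots> = p powr (1 / 2)"
      by (subst powr_add[symmetric]) simp
    also have "\<dots> = sqrt p"
      using t by (simp add: p_def powr_half_sqrt)
    finally have p: "p powr (- 5 / 2) * p ^ 3 = sqrt p" .
    define e where "e = exp (- (\<alpha> * \<beta> / (2 * p)) * (S_fun \<alpha> \<beta> f t)\<^sup>2)"
    have "w t * G t = p powr (- 5 / 2) * p ^ 3 * e"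
      unfolding w_def G_def p_def[symmetric] e_def[symmetric] using \<alpha> by simp
    also have "\<dots> = k t"
      unfolding p using that t less_zeta_iff[of t \<alpha> \<beta>]
      by (simp add: k_def stopped_weight_def inverse_weight_def e_def p_def)
    finally show "w t * G t = k t" .
    have "0 < \<alpha>\<^sup>2" using \<alpha> by simp
    moreover have "\<alpha> ^ 3 = \<alpha> * \<alpha>\<^sup>2" by (simp add: power2_eq_square power3_eq_cube)
    ultimately have "0 < \<alpha> / \<alpha> ^ 3" using \<alpha> by simp
    moreover have "0 < (1 + \<alpha> * \<beta> * t) ^ 3" using t by simp
    ultimately have "0 < (1 + \<alpha> * \<beta> * t) ^ 3 * (\<alpha> / \<alpha> ^ 3)" by (rule mult_pos_pos[rotated])
    then show "0 < w t * \<alpha>" by (simp add: w_def)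
  qed
  \<comment> \<open>On \<open>A\<close> the sign of \<open>w\<close> is that of
    \<open>\<alpha>\<close>, so one component of the signed measure vanishes there. For
    \<open>\<alpha> < 0\<close> also \<open>G\<close> is negative, and subtracting the integral of
    \<open>- k\<close> gives the integral of \<open>k\<close>.\<close>
  have P: "max 0 (w t) * (indicator A t * G t) = (if 0 < \<alpha> then k t else 0)"
    and N: "max 0 (- w t) * (indicator A t * G t) = (if 0 < \<alpha> then 0 else - k t)" for t
  proof -
    have "k t = 0" if "t \<notin> A" using that by (simp add: k_def)
    moreover have "0 < w t" if "t \<in> A" "0 < \<alpha>" using w_sgn[OF that(1)] that(2) by (simp add: zero_less_mult_iff)
    moreover have "w t < 0" if "t \<in> A" "\<not> 0 < \<alpha>" using w_sgn[OF that(1)] that(2) by (simp add: zero_less_mult_iff)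
    ultimately show "max 0 (w t) * (indicator A t * G t) = (if 0 < \<alpha> then k t else 0)"
      "max 0 (- w t) * (indicator A t * G t) = (if 0 < \<alpha> then 0 else - k t)"
      using wG[of t] by (cases "t \<in> A"; cases "0 < \<alpha>"; force simp: max_def)+
  qed
  \<comment> \<open>The truncation hidden in \<open>ennreal\<close> is made explicit, because
    real-valued integration against a density requires a nonnegative density.\<close>
  have ennreal_max: "ennreal (max 0 x) = ennreal x" for x
    by (simp add: max_def ennreal_neg)
  have S: "S_measure \<alpha> \<beta> \<mu> = (density ?\<pi> (\<lambda>t. ennreal (max 0 (w t))), density ?\<pi> (\<lambda>t. ennreal (max 0 (- w t))))"
    unfolding S_measure_def signed_density_def w_def[symmetric] ennreal_max ..
  have dens: "integrable (density ?\<pi> (\<lambda>t. ennreal (v t))) (\<lambda>t. indicator A t * G t) \<longleftrightarrow>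
      integrable ?\<pi> (\<lambda>t. v t * (indicator A t * G t))"
    "(\<integral>t. indicator A t * G t \<partial>density ?\<pi> (\<lambda>t. ennreal (v t))) = (\<integral>t. v t * (indicator A t * G t) \<partial>?\<pi>)"
    if [measurable]: "v \<in> borel_measurable borel" and "\<And>t. 0 \<le> v t" for v
    using that(2) by (auto simp: integrable_density integral_density)
  have w_meas: "(\<lambda>t. max 0 (w t)) \<in> borel_measurable borel" "(\<lambda>t. max 0 (- w t)) \<in> borel_measurable borel"
    by measurable
  show ?thesis
    unfolding signed_set_integrable_def signed_set_integral_def set_integrable_def
      set_lebesgue_integral_def S fst_conv snd_conv real_scaleR_def
      dens[OF w_meas(1) max.cobounded1] dens[OF w_meas(2) max.cobounded1] P N measure_eq
    using k_int by (cases "0 < \<alpha>") simp_all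
qed

end

end

theorem theorem1p2:
  fixes M :: "'a measure" and B :: "real \<Rightarrow> 'a \<Rightarrow> real"
    and f :: "real \<Rightarrow> real" and \<alpha> \<beta> :: real
  assumes "standard_brownian_motion M B"
    and "continuous_on {0..} f" and "f 0 \<noteq> 0" and "\<alpha> \<noteq> 0"
  shows "\<forall>A \<in> sets borel. A \<subseteq> lifetime \<alpha> \<beta> \<longrightarrow>
    (let \<mu> = hitting_law M (hitting_time B \<infinity> f);
         g = (\<lambda>t. \<alpha> ^ 3 * (1 + \<alpha> * \<beta> * t) powr (- 5 / 2)
                  * exp (- (\<alpha> * \<beta> / (2 * (1 + \<alpha> * \<beta> * t))) * (S_fun \<alpha> \<beta> f t)\<^sup>2))
     in signed_set_integrable (S_measure \<alpha> \<beta> \<mu>) A g \<and>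
        measure (hitting_law M (hitting_time B (zeta \<alpha> \<beta>) (S_fun \<alpha> \<beta> f))) A
          = signed_set_integral (S_measure \<alpha> \<beta> \<mu>) A g)"
  unfolding Let_def
  using standard_brownian_motion.law_B_signed[OF assms(1-4)] by blast

end
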